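(* Let $G$ be a finite simple graph of even order $n$ which is of Class $2$. Then $es_{\chi'}(G)= \frac{n}{2}-1$ if and only if $G \cong K_{1} \cup K_{n-1}$ or $G \cong K_{2m+1} \cup K_{2m+1}$ for some positive integer $m$.
   Context: All graphs are finite, simple and have at least one edge. $\chi'(G)$ is the chromatic index and $\Delta(G)$ the maximum degree of $G$. $G$ is of Class 2 if $\chi'(G)=\Delta(G)+1$. The chromatic edge stability index $es_{\chi'}(G)$ is the minimum cardinality of a set of edges $F\subseteq E(G)$ such that $\chi'(G\setminus F)<\chi'(G)$, where $G\setminus F$ is $G$ with the edges of $F$ deleted (all vertices are kept). $K_n$ is the complete graph of order $n$ and $\cup$ between graphs denotes vertex-disjoint union. *)

theory Defs
  imports Main
begin

record 'a ugraph =
  verts :: "'a set"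
  edges :: "'a set set"

definition simple_graph :: "'a ugraph \<Rightarrow> bool" where
  "simple_graph G \<longleftrightarrow> finite (verts G) \<and> (\<forall>e\<in>edges G. e \<subseteq> verts G \<and> card e = 2)"

definition graph_order :: "'a ugraph \<Rightarrow> nat" where
  "graph_order G = card (verts G)"

definition degree :: "'a ugraph \<Rightarrow> 'a \<Rightarrow> nat" where
  "degree G v = card {e \<in> edges G. v \<in> e}"

definition max_degree :: "'a ugraph \<Rightarrow> nat" where
  "max_degree G = Max (degree G ` verts G)"

definition proper_edge_colouring :: "'a ugraph \<Rightarrow> nat \<Rightarrow> ('a set \<Rightarrow> nat) \<Rightarrow> bool" where
  "proper_edge_colouring G k c \<longleftrightarrow>
     (\<forall>e\<in>edges G. c e < k) \<and>
     (\<forall>e\<in>edges G. \<forall>f\<in>edges G. e \<noteq> f \<longrightarrow> e \<inter> f \<noteq> {} \<longrightarrow> c e \<noteq> c f)"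

text \<open>An edgeless graph has chromatic index \<open>0\<close>; such graphs arise by deleting edges.\<close>
definition chromatic_index :: "'a ugraph \<Rightarrow> nat" where
  "chromatic_index G = (LEAST k. \<exists>c. proper_edge_colouring G k c)"

definition class2 :: "'a ugraph \<Rightarrow> bool" where
  "class2 G \<longleftrightarrow> chromatic_index G = max_degree G + 1"

definition delete_edges :: "'a ugraph \<Rightarrow> 'a set set \<Rightarrow> 'a ugraph" where
  "delete_edges G F = \<lparr>verts = verts G, edges = edges G - F\<rparr>"

text \<open>The set of candidates for the minimum is nonempty for a finite graph with at least one
  edge, see \<open>edge_stability_witness\<close> below.\<close>
definition chromatic_edge_stability_index :: "'a ugraph \<Rightarrow> nat" where
  "chromatic_edge_stability_index G =
     (LEAST k. \<exists>F. F \<subseteq> edges G \<and> card F = k \<and>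
        chromatic_index (delete_edges G F) < chromatic_index G)"

definition complete_graph :: "nat \<Rightarrow> nat ugraph" where
  "complete_graph n = \<lparr>verts = {..<n}, edges = {e. e \<subseteq> {..<n} \<and> card e = 2}\<rparr>"

definition disjoint_union :: "'a ugraph \<Rightarrow> 'b ugraph \<Rightarrow> ('a + 'b) ugraph" where
  "disjoint_union G H =
     \<lparr>verts = verts G <+> verts H,
      edges = (image Inl) ` edges G \<union> (image Inr) ` edges H\<rparr>"

definition graph_iso :: "'a ugraph \<Rightarrow> 'b ugraph \<Rightarrow> bool" where
  "graph_iso G H \<longleftrightarrow>
     (\<exists>f. bij_betw f (verts G) (verts H) \<and>
          (\<forall>u\<in>verts G. \<forall>v\<in>verts G. {u, v} \<in> edges G \<longleftrightarrow> {f u, f v} \<in> edges H))"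

lemma simple_graph_complete_graph: "simple_graph (complete_graph n)"
  by (simp add: simple_graph_def complete_graph_def)

lemma simple_graph_disjoint_union:
  "simple_graph G \<Longrightarrow> simple_graph H \<Longrightarrow> simple_graph (disjoint_union G H)"
  by (auto simp: simple_graph_def disjoint_union_def card_image)

lemma simple_graph_delete_edges: "simple_graph G \<Longrightarrow> simple_graph (delete_edges G F)"
  by (simp add: simple_graph_def delete_edges_def)

lemma finite_edges:
  assumes "simple_graph G" shows "finite (edges G)"
proof (rule finite_subset)
  show "edges G \<subseteq> Pow (verts G)" using assms by (auto simp: simple_graph_def)
  show "finite (Pow (verts G))" using assms by (simp add: simple_graph_def)
qed

lemma proper_edge_colouring_exists:
  assumes "simple_graph G" shows "\<exists>k c. proper_edge_colouring G k c"
proof -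
  obtain c where "bij_betw c (edges G) {0..<card (edges G)}"
    using ex_bij_betw_finite_nat[OF finite_edges[OF assms]] by blast
  then have "proper_edge_colouring G (card (edges G)) c"
    by (fastforce simp: proper_edge_colouring_def bij_betw_def inj_on_def)
  then show ?thesis by blast
qed

lemma edge_stability_witness:
  assumes "simple_graph G" and "edges G \<noteq> {}"
  shows "chromatic_index (delete_edges G (edges G)) < chromatic_index G"
proof -
  have "\<exists>c. proper_edge_colouring (delete_edges G (edges G)) 0 c"
    by (simp add: proper_edge_colouring_def delete_edges_def)
  then have "chromatic_index (delete_edges G (edges G)) = 0"
    by (simp add: chromatic_index_def Least_eq_0)
  moreover have "\<exists>c. proper_edge_colouring G (chromatic_index G) c"
    unfolding chromatic_index_def by (rule LeastI_ex[OF proper_edge_colouring_exists[OF assms(1)]])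
  then have "chromatic_index G \<noteq> 0"
    using assms(2) by (auto simp: proper_edge_colouring_def)
  ultimately show ?thesis by simp
qed

end

theory Submission
  imports Defs "HOL-Combinatorics.Transposition"
begin

text \<open>Write \<open>n = 2 * k\<close> and let \<open>d\<close> be the chromatic index, one more than the maximum degree. In a proper
colouring with \<open>d\<close> colours every vertex misses a colour, and a colour missing at some vertex is used on
at most \<open>k - 1\<close> edges. Deleting such a colour class shows that the stability index of a class 2 graph
of even order is at most \<open>k - 1\<close> (\<open>class2_edge_stability_upper_bound\<close>). If equality holds, then no
colour class of any proper \<open>d\<close>-colouring has fewer than \<open>k - 1\<close> edges. As the order is even,
each colour is therefore missing at no vertex or at exactly two; in the second case call it
deficient. This property, recorded in the locale \<open>tight_graph\<close>, is all that the forward direction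
needs: no recolouring may take an edge away from a deficient colour.

Fix a vertex \<open>x\<close> and look only at the edges at \<open>x\<close> that have deficient colours. Vizing's fan
argument, started at such an edge as if it were uncoloured, shows that \<open>x\<close> and the vertices of
the fan miss pairwise disjoint sets of colours, apart from the colour of the first edge
(\<open>fan_disjoint\<close>, \<open>fan_elementary\<close>). Since the neighbours of \<open>x\<close> are finite in number and each misses at
least one colour, reachability in fans is symmetric, and it follows that every neighbour of \<open>x\<close> along
a deficient colour misses exactly one colour, and that every deficient colour present at \<open>x\<close> is missed by
exactly one of these neighbours (\<open>deficient_adj_miss_single\<close>, \<open>ex_deficient_adj_missing\<close>,
\<open>deficient_adj_missing_unique\<close>).

Consequently a vertex missing two colours has no edge of a deficient colour, so it misses all
deficient colours; counting then makes it isolated and the other vertices pairwise adjacent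
(\<open>irregular_clique_pair\<close>). Otherwise every vertex misses exactly one colour. Comparing the
uniqueness statement before and after a Kempe swap of two deficient colours shows that adjacency along
deficient colours is transitive (\<open>deficient_adj_trans\<close>), so the edges of deficient colours form two
disjoint complete graphs of order \<open>k\<close>. A colour that is missing nowhere would be a perfect matching
between the two; copying the colouring of one complete graph to the other along this matching makes
the ends of each matching edge miss the same colour, and that colour can replace the matching colour
altogether, which is impossible (\<open>no_perfect_colour\<close>). Each colour is now missing at exactly one vertex of
each complete graph, so \<open>k\<close> is odd.

For the converse, a matching in two disjoint complete graphs of odd order misses a vertex in each of them.
So \<open>d - 1\<close> colours cover at most \<open>(d - 1) * (k - 1)\<close> edges, whereas the two graphs in question have at
least \<open>d * (k - 1)\<close> edges (\<open>clique_pair_edge_stability\<close>).\<close>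


section \<open>Missing colours and deficient colours\<close>

lemma even_card_Union_of_pairs:
  assumes "finite S" "\<And>e. e \<in> S \<Longrightarrow> card e = 2"
    and "\<And>e f. e \<in> S \<Longrightarrow> f \<in> S \<Longrightarrow> e \<noteq> f \<Longrightarrow> e \<inter> f = {}"
  shows "card (\<Union>S) = 2 * card S"
proof -
  have "finite (\<Union>S)" using assms(1,2) by (intro finite_Union) (auto intro: card_ge_0_finite)
  from card_partition[OF assms(1) this, of 2] show ?thesis using assms by auto
qed

definition clique_pair :: "'a ugraph \<Rightarrow> 'a set \<Rightarrow> 'a set \<Rightarrow> bool" where
  "clique_pair G U W \<longleftrightarrow> verts G = U \<union> W \<and> U \<inter> W = {} \<and>
     edges G = {e. card e = 2 \<and> (e \<subseteq> U \<or> e \<subseteq> W)}"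

locale palette =
  fixes G :: "'a ugraph" and d :: nat
  assumes simple: "simple_graph G"
begin

abbreviation proper :: "('a set \<Rightarrow> nat) \<Rightarrow> bool" where
  "proper c \<equiv> proper_edge_colouring G d c"

definition miss :: "('a set \<Rightarrow> nat) \<Rightarrow> 'a \<Rightarrow> nat set" where
  "miss c v = {a. a < d \<and> (\<forall>e\<in>edges G. v \<in> e \<longrightarrow> c e \<noteq> a)}"

definition unsaturated :: "('a set \<Rightarrow> nat) \<Rightarrow> nat \<Rightarrow> 'a set" where
  "unsaturated c a = {v \<in> verts G. a \<in> miss c v}"

definition deficient_adj :: "('a set \<Rightarrow> nat) \<Rightarrow> 'a \<Rightarrow> 'a \<Rightarrow> bool" where
  "deficient_adj c x y \<longleftrightarrow> {x, y} \<in> edges G \<and> unsaturated c (c {x, y}) \<noteq> {}"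

lemma finite_verts: "finite (verts G)"
  using simple by (simp add: simple_graph_def)

lemma finite_unsaturated [simp]: "finite (unsaturated c a)"
  using finite_verts by (simp add: unsaturated_def)

lemma finite_edge_set: "finite (edges G)"
  using simple by (rule finite_edges)

lemma edgeD:
  assumes "e \<in> edges G" shows "e \<subseteq> verts G" "card e = 2"
  using assms simple by (auto simp: simple_graph_def)

lemma edge_pairD:
  assumes "{x, y} \<in> edges G" shows "x \<noteq> y" "x \<in> verts G" "y \<in> verts G"
  using edgeD[OF assms] by auto

lemma edge_other_end:
  assumes "e \<in> edges G" "x \<in> e"
  obtains y where "e = {x, y}" "x \<noteq> y"
proof -
  obtain u v where "e = {u, v}" "u \<noteq> v" using edgeD(2)[OF assms(1)] unfolding card_2_iff by blast
  then show ?thesis using that[of u] that[of v] assms(2) by auto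
qed

lemma proper_less: "proper c \<Longrightarrow> e \<in> edges G \<Longrightarrow> c e < d"
  by (simp add: proper_edge_colouring_def)

lemma proper_at:
  assumes "proper c" "e \<in> edges G" "f \<in> edges G" "v \<in> e" "v \<in> f" "c e = c f"
  shows "e = f"
  using assms unfolding proper_edge_colouring_def by (metis disjoint_iff)

lemma proper_at_pair:
  assumes "proper c" "{x, y} \<in> edges G" "{x, z} \<in> edges G" "c {x, y} = c {x, z}"
  shows "y = z"
proof -
  have "{x, y} = {x, z}" by (rule proper_at[OF assms(1-3) _ _ assms(4), of x]) auto
  then show ?thesis using edge_pairD(1)[OF assms(2)] by (auto simp: doubleton_eq_iff)
qed

lemma properI:
  assumes "\<And>e. e \<in> edges G \<Longrightarrow> c e < d"
    and "\<And>e f v. e \<in> edges G \<Longrightarrow> f \<in> edges G \<Longrightarrow> v \<in> e \<Longrightarrow> v \<in> f \<Longrightarrow> c e = c f \<Longrightarrow> e = f"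
  shows "proper c"
  using assms unfolding proper_edge_colouring_def by blast

lemma properI_pair:
  assumes "\<And>e. e \<in> edges G \<Longrightarrow> c e < d"
    and "\<And>x y z. {x, y} \<in> edges G \<Longrightarrow> {x, z} \<in> edges G \<Longrightarrow> c {x, y} = c {x, z} \<Longrightarrow> y = z"
  shows "proper c"
proof (rule properI)
  fix e f v assume *: "e \<in> edges G" "f \<in> edges G" "v \<in> e" "v \<in> f" "c e = c f"
  obtain y where "e = {v, y}" using *(1,3) by (rule edge_other_end)
  moreover obtain z where "f = {v, z}" using *(2,4) by (rule edge_other_end)
  ultimately show "e = f" using assms(2)[of v y z] * by auto
qed (rule assms(1))

lemma missD: "a \<in> miss c v \<Longrightarrow> e \<in> edges G \<Longrightarrow> v \<in> e \<Longrightarrow> c e \<noteq> a"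
  by (simp add: miss_def)

lemma not_miss_self: "{x, y} \<in> edges G \<Longrightarrow> c {x, y} \<notin> miss c x" "{x, y} \<in> edges G \<Longrightarrow> c {x, y} \<notin> miss c y"
  by (auto simp: miss_def)

lemma ex_neighbour_of_colour:
  assumes "a < d" "a \<notin> miss c x"
  obtains y where "{x, y} \<in> edges G" "c {x, y} = a"
proof -
  obtain e where "e \<in> edges G" "x \<in> e" "c e = a" using assms by (auto simp: miss_def)
  moreover then obtain y where "e = {x, y}" by (auto elim: edge_other_end)
  ultimately show ?thesis using that by auto
qed

lemma finite_miss [simp]: "finite (miss c v)"
  by (rule finite_subset[of _ "{..<d}"]) (auto simp: miss_def)

lemma card_miss:
  assumes "proper c" shows "card (miss c v) + degree G v = d"
proof -
  let ?S = "{e \<in> edges G. v \<in> e}"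
  have "inj_on c ?S" using proper_at[OF assms] by (auto intro!: inj_onI)
  then have "degree G v = card (c ` ?S)" by (simp add: degree_def card_image)
  moreover have "miss c v \<union> c ` ?S = {..<d}" "miss c v \<inter> c ` ?S = {}"
    using proper_less[OF assms] by (auto simp: miss_def)
  moreover have "finite (c ` ?S)" using finite_edge_set by auto
  ultimately show ?thesis using card_Un_disjoint[of "miss c v" "c ` ?S"] by simp
qed

lemma miss_less: "a \<in> miss c v \<Longrightarrow> a < d"
  by (simp add: miss_def)

lemma unsaturated_iff: "v \<in> verts G \<Longrightarrow> v \<in> unsaturated c a \<longleftrightarrow> a \<in> miss c v"
  by (simp add: unsaturated_def)

lemma unsaturatedD: "v \<in> unsaturated c a \<Longrightarrow> v \<in> verts G" "v \<in> unsaturated c a \<Longrightarrow> a \<in> miss c v"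
  by (auto simp: unsaturated_def)

text \<open>The edges of one colour form a matching, and the unsaturated vertices are those it leaves uncovered.\<close>
lemma card_unsaturated_class:
  assumes "proper c" "a < d"
  shows "card (unsaturated c a) + 2 * card {e \<in> edges G. c e = a} = card (verts G)"
proof -
  let ?S = "{e \<in> edges G. c e = a}"
  have "card (\<Union>?S) = 2 * card ?S"
  proof (rule even_card_Union_of_pairs)
    show "finite ?S" using finite_edge_set by auto
    show "e \<inter> f = {}" if "e \<in> ?S" "f \<in> ?S" "e \<noteq> f" for e f
      using that assms(1) unfolding proper_edge_colouring_def by blast
  qed (auto dest: edgeD)
  moreover have "unsaturated c a \<union> \<Union>?S = verts G" "unsaturated c a \<inter> \<Union>?S = {}"
    using assms(2) edgeD(1) by (auto simp: unsaturated_def miss_def)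
  moreover have "finite (\<Union>?S)" using edgeD(1) by (intro finite_subset[OF _ finite_verts]) auto
  ultimately show ?thesis using card_Un_disjoint[of "unsaturated c a" "\<Union>?S"] by simp
qed

lemma degree_neighbours: "degree G v = card {u. {v, u} \<in> edges G}"
proof -
  have "bij_betw (\<lambda>u. {v, u}) {u. {v, u} \<in> edges G} {e \<in> edges G. v \<in> e}"
  proof (rule bij_betw_imageI)
    show "inj_on (\<lambda>u. {v, u}) {u. {v, u} \<in> edges G}"
      by (auto simp: inj_on_def doubleton_eq_iff)
    show "(\<lambda>u. {v, u}) ` {u. {v, u} \<in> edges G} = {e \<in> edges G. v \<in> e}"
    proof (intro equalityI subsetI)
      fix e assume e: "e \<in> {e \<in> edges G. v \<in> e}"
      then obtain u where "e = {v, u}" using edge_other_end[of e v] by auto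
      then show "e \<in> (\<lambda>u. {v, u}) ` {u. {v, u} \<in> edges G}" using e by auto
    qed auto
  qed
  from bij_betw_same_card[OF this] show ?thesis by (simp add: degree_def)
qed

lemma deficient_adj_commute: "deficient_adj c x y \<longleftrightarrow> deficient_adj c y x"
  by (simp add: deficient_adj_def insert_commute)

lemma deficient_adjD:
  assumes "deficient_adj c x y"
  shows "{x, y} \<in> edges G" "x \<noteq> y" "x \<in> verts G" "y \<in> verts G"
  using assms edge_pairD by (auto simp: deficient_adj_def)

section \<open>Recolouring an edge and swapping a Kempe chain\<close>

lemma proper_recolour:
  assumes "proper c" "{x, y} \<in> edges G" "b \<in> miss c x" "b \<in> miss c y"
  shows "proper (c({x, y} := b))"
proof (rule properI)
  show "(c({x, y} := b)) e < d" if "e \<in> edges G" for e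
    using that assms by (auto simp: proper_less miss_def)
  show "e = f" if "e \<in> edges G" "f \<in> edges G" "v \<in> e" "v \<in> f"
    "(c({x, y} := b)) e = (c({x, y} := b)) f" for e f v
    using that proper_at[OF assms(1), of e f v] missD[OF assms(3)] missD[OF assms(4)]
    by (auto split: if_splits)
qed

lemma miss_recolour:
  assumes "proper c" "{x, y} \<in> edges G" "b \<noteq> c {x, y}" "v \<in> {x, y}"
  shows "c {x, y} \<in> miss (c({x, y} := b)) v"
proof -
  have "(c({x, y} := b)) e \<noteq> c {x, y}" if "e \<in> edges G" "v \<in> e" for e
  proof (cases "e = {x, y}")
    case False
    then have "c e \<noteq> c {x, y}" using proper_at[OF assms(1,2) that(1) assms(4) that(2)] by fastforce
    then show ?thesis using False by simp
  qed (use assms(3) in simp)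
  then show ?thesis using proper_less[OF assms(1,2)] by (auto simp: miss_def)
qed

text \<open>Unions of connected components of the subgraph of the edges coloured \<open>a\<close> or \<open>b\<close>. The set may
contain anything outside the graph, so that complements are closed as well.\<close>
definition kempe_closed :: "('a set \<Rightarrow> nat) \<Rightarrow> nat \<Rightarrow> nat \<Rightarrow> 'a set \<Rightarrow> bool" where
  "kempe_closed c a b S \<longleftrightarrow> (\<forall>e\<in>edges G. c e = a \<or> c e = b \<longrightarrow> e \<subseteq> S \<or> e \<inter> S = {})"

definition kempe_swap :: "('a set \<Rightarrow> nat) \<Rightarrow> nat \<Rightarrow> nat \<Rightarrow> 'a set \<Rightarrow> 'a set \<Rightarrow> nat" where
  "kempe_swap c a b S e = (if e \<inter> S \<noteq> {} then transpose a b (c e) else c e)"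

lemma kempe_closed_Compl: "kempe_closed c a b S \<Longrightarrow> kempe_closed c a b (- S)"
  unfolding kempe_closed_def by blast

text \<open>Edges coloured \<open>a\<close> or \<open>b\<close> do not leave \<open>S\<close>, and transposing \<open>a\<close> and \<open>b\<close> leaves the other
colours alone; so whether an edge is recoloured can be read off at either of its ends. This turns the
effect of a swap into a statement about single vertices.\<close>
lemma kempe_swap_at:
  assumes "kempe_closed c a b S" "e \<in> edges G" "v \<in> e"
  shows "kempe_swap c a b S e = (if v \<in> S then transpose a b (c e) else c e)"
proof (cases "c e = a \<or> c e = b")
  case True
  then have "e \<subseteq> S \<or> e \<inter> S = {}" using assms unfolding kempe_closed_def by blast
  then show ?thesis using assms(3) unfolding kempe_swap_def by auto
qed (simp add: kempe_swap_def)

lemma transpose_less: "a < d \<Longrightarrow> b < d \<Longrightarrow> transpose a b i < d \<longleftrightarrow> i < d"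
  by (auto simp: transpose_def)

lemma proper_kempe_swap:
  assumes "proper c" "kempe_closed c a b S" "a < d" "b < d"
  shows "proper (kempe_swap c a b S)"
proof (rule properI)
  show "kempe_swap c a b S e < d" if "e \<in> edges G" for e
    using that assms by (auto simp: kempe_swap_def transpose_less proper_less)
  show "e = f" if "e \<in> edges G" "f \<in> edges G" "v \<in> e" "v \<in> f"
    "kempe_swap c a b S e = kempe_swap c a b S f" for e f v
  proof -
    have "kempe_swap c a b S e = (if v \<in> S then transpose a b (c e) else c e)"
      "kempe_swap c a b S f = (if v \<in> S then transpose a b (c f) else c f)"
      using kempe_swap_at[OF assms(2)] that by blast+
    then have "c e = c f" using that(5) by (auto simp: transpose_eq_iff split: if_splits)
    then show ?thesis using proper_at[OF assms(1)] that by blast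
  qed
qed

lemma miss_kempe_swap:
  assumes "kempe_closed c a b S" "a < d" "b < d"
  shows "i \<in> miss (kempe_swap c a b S) v \<longleftrightarrow>
    (if v \<in> S then transpose a b i \<in> miss c v else i \<in> miss c v)"
proof -
  have "kempe_swap c a b S e = i \<longleftrightarrow> (if v \<in> S then c e = transpose a b i else c e = i)"
    if "e \<in> edges G" "v \<in> e" for e
    using kempe_swap_at[OF assms(1) that] by (auto simp del: transpose_eq_iff)
  then show ?thesis using assms(2,3) by (auto simp: miss_def transpose_less)
qed

end

text \<open>A Kempe chain starting at a vertex \<open>x\<close> that misses \<open>a\<close> is a path, so it contains at most one
vertex that misses \<open>b\<close>. Instead of handling paths, let \<open>A\<close> and \<open>C\<close> send a vertex to its neighbour along
colour \<open>a\<close> and \<open>b\<close> respectively, or to itself if the colour is missing. The chain is the orbit of \<open>x\<close> under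
these two involutions, and the fixed points of \<open>A\<close> and \<open>C\<close> are the vertices missing \<open>a\<close> and \<open>b\<close>. With
\<open>p = A \<circ> C\<close>, the vertex \<open>(p ^^ j) x\<close> is fixed by \<open>C\<close> only if \<open>2 * j + 1\<close> is a period of \<open>x\<close>. Two
such exponents differ by half of a period; as the period of \<open>x\<close> is odd, they differ by a period.\<close>
lemma involution_orbit:
  fixes A C :: "'b \<Rightarrow> 'b"
  assumes A: "\<And>v. A (A v) = v" and C: "\<And>v. C (C v) = v" and x: "A x = x"
  obtains K where "x \<in> K" "\<And>v. v \<in> K \<Longrightarrow> A v \<in> K" "\<And>v. v \<in> K \<Longrightarrow> C v \<in> K"
    "\<And>y z. y \<in> K \<Longrightarrow> z \<in> K \<Longrightarrow> C y = y \<Longrightarrow> C z = z \<Longrightarrow> y = z"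
proof -
  define p where "p = A \<circ> C"
  define K where "K = (\<Union>j. {(p ^^ j) x, C ((p ^^ j) x)})"
  have inj_p: "p u = p v \<Longrightarrow> u = v" for u v
  proof -
    assume "p u = p v"
    then have "C (A (A (C u))) = C (A (A (C v)))" by (simp add: p_def)
    then show "u = v" by (simp add: A C)
  qed
  have inj_pow: "(p ^^ n) u = (p ^^ n) v \<Longrightarrow> u = v" for n u v
    by (induction n) (auto dest: inj_p)
  have "x \<in> K" unfolding K_def by (auto intro: exI[of _ 0])
  moreover have "A v \<in> K" if v: "v \<in> K" for v
  proof -
    obtain j where "v = (p ^^ j) x \<or> v = C ((p ^^ j) x)" using v unfolding K_def by blast
    then show ?thesis
    proof
      assume "v = C ((p ^^ j) x)"
      then have "A v = (p ^^ Suc j) x" by (simp add: p_def)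
      then show ?thesis unfolding K_def by blast
    next
      assume v: "v = (p ^^ j) x"
      show ?thesis
      proof (cases j)
        case 0
        then show ?thesis using v x \<open>x \<in> K\<close> by simp
      next
        case (Suc i)
        then have "A v = C ((p ^^ i) x)" using v A by (simp add: p_def)
        then show ?thesis unfolding K_def by blast
      qed
    qed
  qed
  moreover have "C v \<in> K" if "v \<in> K" for v using that C unfolding K_def by auto
  moreover have "y = z" if yz: "y \<in> K" "z \<in> K" "C y = y" "C z = z" for y z
  proof -
    have power_form: "\<exists>j. v = (p ^^ j) x" if vK: "v \<in> K" "C v = v" for v
    proof -
      obtain j where "v = (p ^^ j) x \<or> v = C ((p ^^ j) x)" using vK(1) unfolding K_def by blast
      then have "v = (p ^^ j) x" using vK(2) C[of "(p ^^ j) x"] by auto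
      then show ?thesis ..
    qed
    \<comment> \<open>\<open>A\<close> conjugates \<open>p\<close> to its inverse\<close>
    have conj: "(p ^^ j) (A ((p ^^ j) v)) = A v" for j v
    proof (induction j)
      case (Suc j)
      have "(p ^^ Suc j) (A ((p ^^ Suc j) v)) = (p ^^ j) (p (A (p ((p ^^ j) v))))"
        by (simp add: funpow_swap1)
      also have "\<dots> = (p ^^ j) (A ((p ^^ j) v))" by (simp add: p_def A C)
      finally show ?case using Suc by simp
    qed simp
    have odd_period: "(p ^^ (2 * j + 1)) x = x" if "C ((p ^^ j) x) = (p ^^ j) x" for j
    proof -
      have "(p ^^ (2 * j + 1)) x = (p ^^ j) (p ((p ^^ j) x))"
        by (simp add: mult_2 funpow_add funpow_swap1)
      also have "p ((p ^^ j) x) = A ((p ^^ j) x)" using that unfolding p_def comp_apply by simp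
      finally show ?thesis using conj x by simp
    qed
    have *: "(p ^^ i) x = (p ^^ j) x"
      if ij: "j \<le> i" "C ((p ^^ i) x) = (p ^^ i) x" "C ((p ^^ j) x) = (p ^^ j) x" for i j
    proof -
      define t where "t = i - j"
      have i: "2 * i + 1 = (2 * j + 1) + 2 * t" using ij(1) by (simp add: t_def)
      have "(p ^^ (2 * j + 1)) ((p ^^ (2 * t)) x) = (p ^^ (2 * j + 1)) x"
        using odd_period[OF ij(2)] odd_period[OF ij(3)] unfolding i funpow_add by simp
      then have even_period: "(p ^^ (2 * t)) x = x" by (rule inj_pow)
      have e: "((p ^^ m) ^^ n) x = x" if "(p ^^ m) x = x" for m n
        using that by (induction n) auto
      have "(p ^^ (t + (2 * t) * j)) x = (p ^^ ((2 * j + 1) * t)) x" by (simp add: algebra_simps)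
      also have "\<dots> = x" using e[OF odd_period[OF ij(3)], of t] by (simp only: funpow_mult)
      finally have "(p ^^ t) x = x"
        using e[OF even_period, of j] by (simp only: funpow_mult funpow_add comp_apply)
      then have "(p ^^ (j + t)) x = (p ^^ j) x" by (simp add: funpow_add)
      then show ?thesis using ij(1) by (simp add: t_def)
    qed
    obtain i j where "y = (p ^^ i) x" "z = (p ^^ j) x"
      using power_form[OF yz(1,3)] power_form[OF yz(2,4)] by blast
    then show ?thesis using *[of i j] *[of j i] yz by (cases "i \<le> j") auto
  qed
  ultimately show ?thesis using that[of K] by blast
qed

context palette
begin

definition partner :: "('a set \<Rightarrow> nat) \<Rightarrow> nat \<Rightarrow> 'a \<Rightarrow> 'a" where
  "partner c a v = (if \<exists>w. {v, w} \<in> edges G \<and> c {v, w} = a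
     then (THE w. {v, w} \<in> edges G \<and> c {v, w} = a) else v)"

lemma partner_eq:
  assumes "proper c" "{v, w} \<in> edges G" "c {v, w} = a"
  shows "partner c a v = w"
proof -
  have "(THE w. {v, w} \<in> edges G \<and> c {v, w} = a) = w"
    using assms proper_at_pair[OF assms(1)] by (intro the_equality) auto
  then show ?thesis using assms unfolding partner_def by auto
qed

lemma partner_missing: "a \<in> miss c v \<Longrightarrow> partner c a v = v"
  by (auto simp: partner_def dest: missD)

lemma partner_involution:
  assumes "proper c" shows "partner c a (partner c a v) = v"
proof (cases "\<exists>w. {v, w} \<in> edges G \<and> c {v, w} = a")
  case True
  then obtain w where w: "{v, w} \<in> edges G" "c {v, w} = a" by blast
  then have "{w, v} \<in> edges G" "c {w, v} = a" by (auto simp: insert_commute)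
  then show ?thesis using partner_eq[OF assms w] partner_eq[OF assms, of w v a] by simp
next
  case False
  then have "partner c a v = v" by (auto simp: partner_def)
  then show ?thesis by simp
qed

text \<open>The only property of Kempe chains that is needed from their being paths, by \<open>involution_orbit\<close> applied to
the partner maps of the two colours.\<close>
lemma kempe_chain:
  assumes "proper c" "a \<in> miss c x"
  obtains K where "x \<in> K" "kempe_closed c a b K"
    "\<And>y z. y \<in> K \<Longrightarrow> z \<in> K \<Longrightarrow> b \<in> miss c y \<Longrightarrow> b \<in> miss c z \<Longrightarrow> y = z"
proof -
  obtain K where K: "x \<in> K" "\<And>v. v \<in> K \<Longrightarrow> partner c a v \<in> K" "\<And>v. v \<in> K \<Longrightarrow> partner c b v \<in> K"
    "\<And>y z. y \<in> K \<Longrightarrow> z \<in> K \<Longrightarrow> partner c b y = y \<Longrightarrow> partner c b z = z \<Longrightarrow> y = z"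
    by (rule involution_orbit[of "partner c a" "partner c b" x,
      OF partner_involution[OF assms(1)] partner_involution[OF assms(1)]
      partner_missing[OF assms(2)]]) blast
  have "e \<subseteq> K" if e: "e \<in> edges G" "c e = a \<or> c e = b" "v \<in> e" "v \<in> K" for e v
  proof -
    obtain w where w: "e = {v, w}" using e(1,3) by (rule edge_other_end)
    have "partner c (c e) v = w" using partner_eq[OF assms(1), of v w] e w by auto
    then have "w \<in> K" using K(2,3) e by metis
    then show ?thesis using w e by auto
  qed
  then have "kempe_closed c a b K" unfolding kempe_closed_def by blast
  moreover have "y = z" if "y \<in> K" "z \<in> K" "b \<in> miss c y" "b \<in> miss c z" for y z
    using K(4)[OF that(1,2)] partner_missing that(3,4) by simp
  ultimately show ?thesis using that[of K] K(1) by simp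
qed

section \<open>Fans\<close>

text \<open>Vizing fans at \<open>x\<close>, listed from the last vertex to the first one: the colour of the edge from \<open>x\<close> to
each vertex but the first is missing at the vertex that precedes it in the fan, the next one in the
list. In this order the last vertex can be peeled off by recursion and the root edge stays in place.\<close>
fun fan :: "('a set \<Rightarrow> nat) \<Rightarrow> 'a \<Rightarrow> 'a list \<Rightarrow> bool" where
  "fan c x [] = False"
| "fan c x [y] = ({x, y} \<in> edges G)"
| "fan c x (z # y # ys) =
    ({x, z} \<in> edges G \<and> c {x, z} \<in> miss c y \<and> z \<notin> set (y # ys) \<and> fan c x (y # ys))"

lemma fan_edge: "fan c x ys \<Longrightarrow> y \<in> set ys \<Longrightarrow> {x, y} \<in> edges G"
  by (induction c x ys rule: fan.induct) auto

lemma fan_distinct: "fan c x ys \<Longrightarrow> distinct ys"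
  by (induction c x ys rule: fan.induct) auto

lemma fan_cong:
  assumes "fan c x ys" "\<And>w. w \<in> set ys \<Longrightarrow> c' {x, w} = c {x, w}"
    and "\<And>w z. w \<in> set (tl ys) \<Longrightarrow> z \<in> set ys \<Longrightarrow> c {x, z} \<in> miss c w \<Longrightarrow> c {x, z} \<in> miss c' w"
  shows "fan c' x ys"
  using assms
proof (induction c x ys rule: fan.induct)
  case (3 c x z y ys)
  have "fan c' x (y # ys)"
  proof (rule 3(1))
    show "fan c x (y # ys)" using 3(2) by simp
    show "c' {x, w} = c {x, w}" if "w \<in> set (y # ys)" for w using 3(3) that by auto
    show "c {x, u} \<in> miss c' w" if "w \<in> set (tl (y # ys))" "u \<in> set (y # ys)" "c {x, u} \<in> miss c w" for w u
      using 3(4)[of w u] that by auto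
  qed
  then show ?case using 3(2) 3(3)[of z] 3(4)[of y z] by auto
qed auto

lemma fan_suffix:
  assumes "fan c x ys" "z \<in> set ys"
  obtains zs where "fan c x (z # zs)" "last (z # zs) = last ys" "set (z # zs) \<subseteq> set ys"
proof -
  have "\<exists>zs. fan c x (z # zs) \<and> last (z # zs) = last ys \<and> set (z # zs) \<subseteq> set ys" using assms
  proof (induction c x ys rule: fan.induct)
    case (3 c x u y ys)
    show ?case
    proof (cases "z = u")
      case True
      then show ?thesis using 3 by (intro exI[of _ "y # ys"]) auto
    next
      case False
      then have "z \<in> set (y # ys)" using 3(3) by auto
      then obtain zs where "fan c x (z # zs)" "last (z # zs) = last (y # ys)" "set (z # zs) \<subseteq> set (y # ys)"
        using 3(1) 3(2) by auto
      then show ?thesis by (intro exI[of _ zs]) auto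
    qed
  qed auto
  then show ?thesis using that by blast
qed

text \<open>The relation whose simple paths are the fans at \<open>x\<close>.\<close>
definition fan_step :: "('a set \<Rightarrow> nat) \<Rightarrow> 'a \<Rightarrow> ('a \<times> 'a) set" where
  "fan_step c x = {(y, z). {x, y} \<in> edges G \<and> {x, z} \<in> edges G \<and> c {x, z} \<in> miss c y}"

lemma fan_of_reachable:
  assumes "(y, z) \<in> (fan_step c x)\<^sup>*" "{x, y} \<in> edges G"
  obtains zs where "fan c x (z # zs)" "last (z # zs) = y"
proof -
  have "\<exists>zs. fan c x (z # zs) \<and> last (z # zs) = y" using assms
  proof (induction rule: rtrancl_induct)
    case base
    then show ?case by (intro exI[of _ "[]"]) auto
  next
    case (step u v)
    then obtain zs where zs: "fan c x (u # zs)" "last (u # zs) = y" by auto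
    show ?case
    proof (cases "v \<in> set (u # zs)")
      case True
      then show ?thesis using fan_suffix[OF zs(1) True] zs(2) by metis
    next
      case False
      then show ?thesis using zs step(2) by (intro exI[of _ "u # zs"]) (auto simp: fan_step_def)
    qed
  qed
  then show ?thesis using that by blast
qed

end

section \<open>Tight graphs: no colour class can be made small\<close>

text \<open>The consequences of an extremal stability index that the structure theory uses. The last assumption
speaks about all proper colourings, so it survives every recolouring.\<close>
locale tight_graph = palette G d for G :: "'a ugraph" and d :: nat +
  fixes k :: nat
  assumes order: "card (verts G) = 2 * k" and k_ge: "2 \<le> k"
    and degree_less: "v \<in> verts G \<Longrightarrow> degree G v < d"
    and tight: "proper c \<Longrightarrow> a < d \<Longrightarrow> k - 1 \<le> card {e \<in> edges G. c e = a}"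
begin

text \<open>At most two vertices miss a colour because its class has at least \<open>k - 1\<close> edges, and one vertex
alone is impossible because the order is even.\<close>
lemma card_unsaturated:
  assumes "proper c" "a < d" shows "card (unsaturated c a) = 0 \<or> card (unsaturated c a) = 2"
proof -
  have "card (unsaturated c a) + 2 * card {e \<in> edges G. c e = a} = 2 * k"
    using card_unsaturated_class[OF assms] order by simp
  moreover have "k \<le> card {e \<in> edges G. c e = a} + 1" using tight[OF assms] by simp
  ultimately show ?thesis by presburger
qed

lemma card_unsaturated_le: "proper c \<Longrightarrow> card (unsaturated c a) \<le> 2"
proof (cases "a < d")
  case False
  then have "unsaturated c a = {}" by (auto simp: unsaturated_def miss_def)
  then show ?thesis by simp
qed (use card_unsaturated in force)

lemma unsaturated_less: "v \<in> unsaturated c a \<Longrightarrow> a < d"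
  by (auto simp: unsaturated_def miss_def)

lemma obtain_unsaturated_pair:
  assumes "proper c" "v \<in> unsaturated c a"
  obtains w where "unsaturated c a = {v, w}" "w \<noteq> v"
proof -
  have "card (unsaturated c a) = 2" using card_unsaturated[OF assms(1) unsaturated_less[OF assms(2)]] assms(2) by auto
  then obtain p q where "unsaturated c a = {p, q}" "p \<noteq> q" unfolding card_2_iff by blast
  then show ?thesis using assms(2) that[of p] that[of q] by auto
qed

lemma unsaturated_subset_pair:
  assumes "proper c" "y \<in> unsaturated c a" "z \<in> unsaturated c a" "y \<noteq> z" "w \<in> unsaturated c a"
  shows "w = y \<or> w = z"
proof -
  obtain u where "unsaturated c a = {y, u}" using assms(1,2) by (rule obtain_unsaturated_pair)
  then show ?thesis using assms by auto
qed

lemma ex_miss: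
  assumes "proper c" "v \<in> verts G" obtains a where "a \<in> miss c v"
proof -
  have "card (miss c v) \<noteq> 0" using card_miss[OF assms(1), of v] degree_less[OF assms(2)] by linarith
  then show ?thesis using that by fastforce
qed

text \<open>If the ends of an edge miss a common colour, recolouring the edge takes it out of its class. Had that class
already missed two vertices, it would now miss four.\<close>
lemma recolour_perfect:
  assumes "proper c" "{x, y} \<in> edges G" "b \<in> miss c x" "b \<in> miss c y"
  shows "unsaturated c (c {x, y}) = {}"
proof (rule ccontr)
  assume ne: "unsaturated c (c {x, y}) \<noteq> {}"
  let ?a = "c {x, y}" and ?c = "c({x, y} := b)"
  have ba: "b \<noteq> ?a" using missD[OF assms(3,2)] by auto
  obtain v where v: "v \<in> unsaturated c ?a" using ne by blast
  obtain w where w: "unsaturated c ?a = {v, w}" "w \<noteq> v" using assms(1) v by (rule obtain_unsaturated_pair)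
  have "x \<notin> unsaturated c ?a" "y \<notin> unsaturated c ?a"
    using not_miss_self[OF assms(2)] by (auto dest: unsaturatedD)
  then have 4: "card {x, y, v, w} = 4" using w edge_pairD(1)[OF assms(2)] by auto
  have x: "?a \<in> miss ?c x" and y: "?a \<in> miss ?c y"
    using miss_recolour[OF assms(1,2) ba] by auto
  have "unsaturated c ?a \<subseteq> unsaturated ?c ?a" using ba by (auto simp: unsaturated_def miss_def)
  then have "{x, y, v, w} \<subseteq> unsaturated ?c ?a"
    using x y edge_pairD[OF assms(2)] w by (auto simp: unsaturated_iff)
  then have "card {x, y, v, w} \<le> card (unsaturated ?c ?a)" by (rule card_mono[OF finite_unsaturated])
  then show False using 4 card_unsaturated_le[OF proper_recolour[OF assms], of ?a] by linarith
qed

lemma deficient_adj_miss_disjoint: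
  assumes "proper c" "deficient_adj c x y" shows "miss c x \<inter> miss c y = {}"
  using recolour_perfect[OF assms(1) deficient_adjD(1)[OF assms(2)]] assms(2) by (auto simp: deficient_adj_def)

text \<open>Shifting a fan: if \<open>x\<close> and the last vertex \<open>z\<close> miss a common colour \<open>b\<close>, recolour the edge between them with
\<open>b\<close>. Its old colour becomes missing at \<open>x\<close> and is also missing at the preceding vertex, so a shorter fan with the
same root edge violates the claim. The induction ends at a single root edge of a deficient
colour, where \<open>recolour_perfect\<close> applies.\<close>
lemma fan_disjoint:
  assumes "proper c" "fan c x ys" "deficient_adj c x (last ys)"
  shows "miss c x \<inter> miss c (hd ys) = {}"
  using assms
proof (induction ys arbitrary: c rule: induct_list012)
  case (3 z y ys)
  note c = 3(3) and fan = 3(4) and root = 3(5)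
  let ?y0 = "last (y # ys)" and ?zc = "c {x, z}"
  show ?case
  proof (rule ccontr)
    assume "\<not> ?case"
    then obtain b where b: "b \<in> miss c x" "b \<in> miss c z" by auto
    have xz: "{x, z} \<in> edges G" and zy: "?zc \<in> miss c y" and z: "z \<notin> set (y # ys)"
      and tail: "fan c x (y # ys)" using fan by auto
    have y0: "?y0 \<in> set (y # ys)" by (rule last_in_set) simp
    have edge: "{x, w} \<in> edges G" if "w \<in> set (y # ys)" for w using fan_edge[OF tail that] .
    have ne: "{x, w} \<noteq> {x, z}" "w \<noteq> x" if "w \<in> set (y # ys)" for w
      using that z edge_pairD(1)[OF xz] edge_pairD(1)[OF edge[OF that]] by (auto simp: doubleton_eq_iff)
    have bz: "b \<noteq> ?zc" using missD[OF b(1) xz] by auto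
    let ?c = "c({x, z} := b)"
    have proper': "proper ?c" by (rule proper_recolour[OF c xz b])
    have miss': "miss ?c w = miss c w" if "w \<in> set (y # ys)" for w
      using ne[OF that] that z by (auto simp: miss_def)
    have fan': "fan ?c x (y # ys)"
    proof (rule fan_cong[OF tail])
      show "?c {x, w} = c {x, w}" if "w \<in> set (y # ys)" for w using ne[OF that] by auto
      show "c {x, u} \<in> miss ?c w" if "w \<in> set (tl (y # ys))" "u \<in> set (y # ys)"
        "c {x, u} \<in> miss c w" for w u using miss'[of w] that by auto
    qed
    let ?a = "c {x, ?y0}"
    have "?a \<noteq> b" using missD[OF b(1) edge[OF y0]] by auto
    then have "unsaturated c ?a \<subseteq> unsaturated ?c ?a" by (auto simp: unsaturated_def miss_def)
    moreover have "?c {x, ?y0} = ?a" using ne(1)[OF y0] by auto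
    ultimately have root': "deficient_adj ?c x ?y0" using root edge[OF y0] by (auto simp: deficient_adj_def)
    have "?zc \<in> miss ?c x"
      by (rule miss_recolour[OF c xz bz]) simp
    moreover have "?zc \<in> miss ?c y" using zy miss'[of y] by simp
    ultimately show False using 3(2)[OF proper' fan' root', unfolded list.sel] by blast
  qed
qed (auto dest: deficient_adj_miss_disjoint)

lemma reachable_disjoint:
  assumes "proper c" "deficient_adj c x y" "(y, z) \<in> (fan_step c x)\<^sup>*"
  shows "miss c x \<inter> miss c z = {}"
proof -
  obtain zs where zs: "fan c x (z # zs)" "last (z # zs) = y"
    using assms(3) deficient_adjD(1)[OF assms(2)] by (rule fan_of_reachable)
  show ?thesis using fan_disjoint[OF assms(1) zs(1)] assms(2) zs(2) by simp
qed

text \<open>Swapping \<open>a\<close> and \<open>b\<close> outside \<open>K\<close> changes nothing at \<open>x\<close> and nothing that the fan uses, but makes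
\<open>a\<close> missing at the last vertex \<open>y\<close> as well as at \<open>x\<close>, contrary to \<open>fan_disjoint\<close>.\<close>
lemma no_fan_outside_chain:
  assumes c: "proper c" and fan: "fan c x (y # ys)" and root: "deficient_adj c x (last (y # ys))"
    and b: "b \<in> miss c y" "b \<noteq> c {x, last (y # ys)}"
    and a: "a \<in> miss c x" and K: "x \<in> K" "kempe_closed c a b K"
    and y: "y \<notin> K" and ys: "\<And>z. z \<in> set ys \<Longrightarrow> b \<in> miss c z \<Longrightarrow> z \<in> K"
  shows False
proof -
  let ?S = "- K" and ?y0 = "last (y # ys)"
  let ?c = "kempe_swap c a b ?S"
  note S = kempe_closed_Compl[OF K(2)]
  have ab: "a < d" "b < d" using a b miss_less by auto
  have proper': "proper ?c" by (rule proper_kempe_swap[OF c S ab])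
  have edge: "{x, w} \<in> edges G" if "w \<in> set (y # ys)" for w using fan_edge[OF fan that] .
  have same: "?c {x, w} = c {x, w}" if "w \<in> set (y # ys)" for w
    using kempe_swap_at[OF S edge[OF that], of x] K(1) by simp
  have xa: "c {x, w} \<noteq> a" if "w \<in> set (y # ys)" for w using missD[OF a edge[OF that]] by simp
  have fan': "fan ?c x (y # ys)"
  proof (rule fan_cong[OF fan same])
    show "c {x, u} \<in> miss ?c w" if "w \<in> set (tl (y # ys))" "u \<in> set (y # ys)"
      "c {x, u} \<in> miss c w" for w u
    proof (cases "w \<in> K")
      case True
      then show ?thesis using that(3) by (simp add: miss_kempe_swap[OF S ab])
    next
      case False
      then have "c {x, u} \<noteq> b" using ys[of w] that(1,3) by auto
      then show ?thesis using xa[OF that(2)] that(3) by (simp add: miss_kempe_swap[OF S ab])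
    qed
  qed
  have y0: "?y0 \<in> set (y # ys)" by (rule last_in_set) simp
  have "unsaturated ?c (c {x, ?y0}) = unsaturated c (c {x, ?y0})"
    using xa[OF y0] b(2) by (auto simp: unsaturated_def miss_kempe_swap[OF S ab])
  then have root': "deficient_adj ?c x ?y0" using root same[OF y0] by (simp add: deficient_adj_def)
  have "a \<in> miss ?c x" "a \<in> miss ?c y"
    using a b y K(1) by (auto simp: miss_kempe_swap[OF S ab])
  then show False using fan_disjoint[OF proper' fan' root'] by auto
qed

text \<open>Let \<open>a\<close> be a colour missing at \<open>x\<close> and \<open>K\<close> the chain in the colours \<open>a\<close> and \<open>b\<close> from \<open>x\<close>. At most one
of \<open>y\<close> and \<open>z\<close> lies on \<open>K\<close>, so \<open>no_fan_outside_chain\<close> applies to a fan that ends in the other one.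
Since \<open>y\<close> and \<open>z\<close> are the only vertices missing \<open>b\<close>, its side condition concerns only the
case that both lie outside \<open>K\<close> and the fan ending in one of them runs through the other one, and then the
fan is cut off there.\<close>
lemma fan_elementary:
  assumes c: "proper c" and root: "deficient_adj c x y0"
    and y: "(y0, y) \<in> (fan_step c x)\<^sup>*" and z: "(y0, z) \<in> (fan_step c x)\<^sup>*"
    and b: "b \<in> miss c y" "b \<in> miss c z" "b \<noteq> c {x, y0}"
  shows "y = z"
proof (rule ccontr)
  assume "y \<noteq> z"
  obtain ys where ys: "fan c x (y # ys)" "last (y # ys) = y0"
    using y deficient_adjD(1)[OF root] by (rule fan_of_reachable)
  obtain zs where zs: "fan c x (z # zs)" "last (z # zs) = y0"
    using z deficient_adjD(1)[OF root] by (rule fan_of_reachable)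
  have verts: "y \<in> verts G" "z \<in> verts G"
    using fan_edge[OF ys(1), of y] fan_edge[OF zs(1), of z] edge_pairD by auto
  have only: "w = y \<or> w = z" if "w \<in> set ws" "fan c x ws" "b \<in> miss c w" for w ws
    using unsaturated_subset_pair[OF c _ _ \<open>y \<noteq> z\<close>] verts b(1,2) that fan_edge[OF that(2,1)]
    by (meson unsaturated_iff edge_pairD(3))
  obtain a where a: "a \<in> miss c x" using c deficient_adjD(3)[OF root] by (rule ex_miss)
  obtain K where K: "x \<in> K" "kempe_closed c a b K"
    "\<And>y z. y \<in> K \<Longrightarrow> z \<in> K \<Longrightarrow> b \<in> miss c y \<Longrightarrow> b \<in> miss c z \<Longrightarrow> y = z"
    using c a by (rule kempe_chain[where b = b]) blast
  have bad: False if "fan c x (u # us)" "last (u # us) = y0" "b \<in> miss c u" "u \<notin> K"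
    "\<And>w. w \<in> set us \<Longrightarrow> b \<in> miss c w \<Longrightarrow> w \<in> K" for u us
    using no_fan_outside_chain[OF c that(1) _ that(3) _ a K(1,2) that(4,5)] root b(3) that(2) by simp
  consider "y \<in> K" | "z \<in> K" | "y \<notin> K" "z \<notin> K" by blast
  then show False
  proof cases
    case 1
    then have "z \<notin> K" using K(3)[of y z] b \<open>y \<noteq> z\<close> by blast
    moreover have "w \<in> K" if "w \<in> set zs" "b \<in> miss c w" for w
      using only[OF _ zs(1), of w] that fan_distinct[OF zs(1)] 1 by auto
    ultimately show False using bad[OF zs b(2)] by blast
  next
    case 2
    then have "y \<notin> K" using K(3)[of y z] b \<open>y \<noteq> z\<close> by blast
    moreover have "w \<in> K" if "w \<in> set ys" "b \<in> miss c w" for w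
      using only[OF _ ys(1), of w] that fan_distinct[OF ys(1)] 2 by auto
    ultimately show False using bad[OF ys b(1)] by blast
  next
    case 3
    show False
    proof (cases "z \<in> set ys")
      case False
      then have "w \<in> K" if "w \<in> set ys" "b \<in> miss c w" for w
        using only[OF _ ys(1), of w] that fan_distinct[OF ys(1)] by auto
      then show False using bad[OF ys b(1) 3(1)] by blast
    next
      case True
      then obtain u us where [simp]: "ys = u # us" by (cases ys) auto
      have "fan c x ys" using ys(1) by simp
      then obtain ws where ws: "fan c x (z # ws)" "last (z # ws) = last ys" "set (z # ws) \<subseteq> set ys"
        using True by (rule fan_suffix)
      have "w \<in> K" if "w \<in> set ws" "b \<in> miss c w" for w
        using only[OF _ ws(1), of w] that fan_distinct[OF ws(1)] fan_distinct[OF ys(1)] ws(3) by auto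
      moreover have "last (z # ws) = y0" using ws(2) ys(2) by simp
      ultimately show False using bad[OF ws(1) _ b(2) 3(2)] by blast
    qed
  qed
qed

section \<open>The edges at a vertex that lie in deficient colours\<close>

lemma reachable_deficient_adj:
  assumes "(y, z) \<in> (fan_step c x)\<^sup>*" "deficient_adj c x y" shows "deficient_adj c x z"
  using assms
proof (induction rule: rtrancl_induct)
  case (step u v)
  then have "u \<in> unsaturated c (c {x, v})"
    using deficient_adjD(4) by (auto simp: fan_step_def unsaturated_iff)
  then show ?case using step(2) by (auto simp: deficient_adj_def fan_step_def)
qed

lemma finite_deficient_adj: "finite {y. deficient_adj c x y}"
  by (rule finite_subset[OF _ finite_verts]) (auto dest: deficient_adjD)

text \<open>If no reachable vertex missed the colour of the root edge, then sending each reachable vertex to the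
neighbour of \<open>x\<close> along some colour it misses would be an injection, by \<open>fan_elementary\<close>, of the finite
reachable set into itself that avoids \<open>y0\<close>.\<close>
lemma reachable_missing_root_colour:
  assumes c: "proper c" and root: "deficient_adj c x y0"
  obtains z where "(y0, z) \<in> (fan_step c x)\<^sup>*" "c {x, y0} \<in> miss c z"
proof -
  let ?R = "{y. (y0, y) \<in> (fan_step c x)\<^sup>*}"
  have "\<exists>z\<in>?R. c {x, y0} \<in> miss c z"
  proof (rule ccontr)
    assume none: "\<not> ?thesis"
    have "\<exists>z. z \<in> ?R - {y0} \<and> c {x, z} \<in> miss c y" if "y \<in> ?R" for y
    proof -
      have y: "deficient_adj c x y" using that reachable_deficient_adj root by blast
      obtain b where b: "b \<in> miss c y" using c deficient_adjD(4)[OF y] by (rule ex_miss)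
      then have "b \<notin> miss c x" using reachable_disjoint[OF c root, of y] that by auto
      then obtain z where z: "{x, z} \<in> edges G" "c {x, z} = b"
        using b miss_less by (blast intro: ex_neighbour_of_colour)
      then have "(y, z) \<in> fan_step c x" using b deficient_adjD(1)[OF y] by (auto simp: fan_step_def)
      then have "z \<in> ?R" using that by auto
      moreover have "z \<noteq> y0" using none b z that by auto
      ultimately show ?thesis using b z by auto
    qed
    then obtain f where f: "\<And>y. y \<in> ?R \<Longrightarrow> f y \<in> ?R - {y0} \<and> c {x, f y} \<in> miss c y" by metis
    have "inj_on f ?R"
    proof (rule inj_onI)
      fix y z assume yz: "y \<in> ?R" "z \<in> ?R" "f y = f z"
      have "{x, f y} \<in> edges G" using f[OF yz(1)] reachable_deficient_adj root deficient_adjD(1) by blast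
      then have "c {x, f y} \<noteq> c {x, y0}"
        using proper_at_pair[OF c _ deficient_adjD(1)[OF root]] f[OF yz(1)] by blast
      then show "y = z" using fan_elementary[OF c root] f[OF yz(1)] f[OF yz(2)] yz by auto
    qed
    moreover have "f ` ?R \<subseteq> ?R - {y0}" using f by blast
    moreover have "finite ?R"
      by (rule finite_subset[OF _ finite_deficient_adj]) (use reachable_deficient_adj root in blast)
    ultimately have "card ?R \<le> card (?R - {y0})" by (metis card_inj_on_le finite_Diff)
    moreover have "card (?R - {y0}) < card ?R"
      using \<open>finite ?R\<close> by (intro card_Diff1_less) auto
    ultimately show False by linarith
  qed
  then show ?thesis using that by blast
qed

text \<open>It suffices to go back along one step from \<open>u\<close> to \<open>v\<close>. The colour of the edge from \<open>x\<close> to \<open>v\<close> is missing at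
some vertex reachable from \<open>v\<close>; it is also missing at \<open>u\<close>, and by \<open>fan_elementary\<close>, with the fan rooted
at \<open>y0\<close>, these two vertices coincide.\<close>
lemma reachable_sym:
  assumes c: "proper c" and root: "deficient_adj c x y0" and y: "(y0, y) \<in> (fan_step c x)\<^sup>*"
  shows "(y, y0) \<in> (fan_step c x)\<^sup>*"
  using y
proof (induction rule: rtrancl_induct)
  case (step u v)
  show ?case
  proof (cases "v = y0")
    case False
    have v: "(y0, v) \<in> (fan_step c x)\<^sup>*" using step by auto
    then have xv: "deficient_adj c x v" using root reachable_deficient_adj by blast
    obtain z where z: "(v, z) \<in> (fan_step c x)\<^sup>*" "c {x, v} \<in> miss c z"
      using c xv by (rule reachable_missing_root_colour)
    have "c {x, v} \<noteq> c {x, y0}"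
      using proper_at_pair[OF c deficient_adjD(1)[OF xv] deficient_adjD(1)[OF root]] False by blast
    moreover have "c {x, v} \<in> miss c u" using step(2) by (simp add: fan_step_def)
    moreover have "(y0, z) \<in> (fan_step c x)\<^sup>*" using v z(1) by simp
    ultimately have "u = z" using fan_elementary[OF c root] step(1) z(2) by blast
    then show ?thesis using z(1) step(3) by simp
  qed simp
qed simp

text \<open>From both \<open>y\<close> and \<open>z\<close> one step leads to the neighbour of \<open>x\<close> along \<open>b\<close>, so by symmetry \<open>z\<close> is
reachable from \<open>y\<close>. The edge from \<open>x\<close> to \<open>y\<close> does not have colour \<open>b\<close>, hence \<open>fan_elementary\<close> rooted at
\<open>y\<close> covers the colour \<open>b\<close>.\<close>
lemma deficient_adj_missing_unique:
  assumes c: "proper c" and y: "deficient_adj c x y" and z: "deficient_adj c x z" and b: "b \<in> miss c y" "b \<in> miss c z"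
  shows "y = z"
proof -
  have "b \<notin> miss c x" using deficient_adj_miss_disjoint[OF c y] b by auto
  then obtain w where w: "{x, w} \<in> edges G" "c {x, w} = b"
    using b miss_less by (blast intro: ex_neighbour_of_colour)
  have "(y, w) \<in> fan_step c x" "(z, w) \<in> fan_step c x"
    using w b deficient_adjD(1)[OF y] deficient_adjD(1)[OF z] by (auto simp: fan_step_def)
  then have yw: "(y, w) \<in> (fan_step c x)\<^sup>*" and "(w, z) \<in> (fan_step c x)\<^sup>*"
    using reachable_sym[OF c z] by auto
  then have "(y, z) \<in> (fan_step c x)\<^sup>*" by simp
  moreover have "b \<noteq> c {x, y}" using missD[OF b(1) deficient_adjD(1)[OF y]] by auto
  ultimately show ?thesis using fan_elementary[OF c y _ _ b] by blast
qed

lemma ex_deficient_adj_missing: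
  assumes c: "proper c" and b: "unsaturated c b \<noteq> {}" "b \<notin> miss c x"
  obtains y where "deficient_adj c x y" "b \<in> miss c y"
proof -
  have "b < d" using b(1) unsaturated_less by blast
  then obtain w where w: "{x, w} \<in> edges G" "c {x, w} = b"
    using b(2) by (rule ex_neighbour_of_colour)
  then have xw: "deficient_adj c x w" using b by (simp add: deficient_adj_def)
  obtain z where "(w, z) \<in> (fan_step c x)\<^sup>*" "c {x, w} \<in> miss c z"
    using c xw by (rule reachable_missing_root_colour)
  then show ?thesis using that reachable_deficient_adj xw w by blast
qed

text \<open>Sending a neighbour \<open>u\<close> of \<open>x\<close> to the neighbour that misses the colour of the edge from \<open>x\<close> to \<open>u\<close> is a
surjection of a finite set onto itself, hence injective. A neighbour \<open>y\<close> has one preimage for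
each colour that it misses.\<close>
lemma deficient_adj_miss_single:
  assumes c: "proper c" and y: "deficient_adj c x y" and ab: "a \<in> miss c y" "b \<in> miss c y"
  shows "a = b"
proof -
  let ?M = "{y. deficient_adj c x y}"
  have "\<exists>z. z \<in> ?M \<and> c {x, u} \<in> miss c z" if "u \<in> ?M" for u
    using that ex_deficient_adj_missing[OF c, of "c {x, u}" x] not_miss_self(1)[of x u c] deficient_adjD(1)[of c x u]
    unfolding deficient_adj_def by blast
  then obtain f where f: "\<And>u. u \<in> ?M \<Longrightarrow> f u \<in> ?M \<and> c {x, u} \<in> miss c (f u)" by metis
  have preimage: "\<exists>w\<in>?M. f w = v \<and> c {x, w} = e" if v: "deficient_adj c x v" and e: "e \<in> miss c v" for v e
  proof -
    have "e \<notin> miss c x" using deficient_adj_miss_disjoint[OF c v] e by auto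
    then obtain w where w: "{x, w} \<in> edges G" "c {x, w} = e"
      using e miss_less by (blast intro: ex_neighbour_of_colour)
    have "v \<in> unsaturated c e" using e deficient_adjD(4)[OF v] by (simp add: unsaturated_iff)
    then have "w \<in> ?M" using w by (auto simp: deficient_adj_def)
    then show ?thesis using f[of w] deficient_adj_missing_unique[OF c _ v _ e, of "f w"] w by blast
  qed
  have "?M \<subseteq> f ` ?M"
  proof
    fix v assume "v \<in> ?M"
    then have v: "deficient_adj c x v" by simp
    obtain e where "e \<in> miss c v" using c deficient_adjD(4)[OF v] by (rule ex_miss)
    then show "v \<in> f ` ?M" using preimage[OF v] by blast
  qed
  then have "inj_on f ?M" using finite_deficient_adj by (rule finite_surj_inj[rotated])
  moreover obtain v w where "v \<in> ?M" "f v = y" "c {x, v} = a" "w \<in> ?M" "f w = y" "c {x, w} = b"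
    using preimage[OF y] ab by blast
  ultimately show ?thesis by (auto dest: inj_onD)
qed

section \<open>Irregular colourings: one isolated vertex\<close>

text \<open>By \<open>deficient_adj_miss_single\<close> such a vertex has no edge in a deficient colour.\<close>
lemma misses_all_deficient:
  assumes c: "proper c" and w: "w \<in> verts G" "a \<in> miss c w" "b \<in> miss c w" "a \<noteq> b"
    and e: "unsaturated c e \<noteq> {}"
  shows "w \<in> unsaturated c e"
proof (rule ccontr)
  assume "w \<notin> unsaturated c e"
  then have "e \<notin> miss c w" using w(1) by (simp add: unsaturated_iff)
  with c e obtain y where "deficient_adj c w y" by (rule ex_deficient_adj_missing)
  then have "deficient_adj c y w" by (simp add: deficient_adj_commute)
  then show False using deficient_adj_miss_single[OF c _ w(2,3)] w(4) by blast
qed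

text \<open>Every deficient colour is missing at \<open>w\<close> and at one further vertex, so distinct vertices other than \<open>w\<close> miss
distinct colours and \<open>w\<close> misses at least \<open>2 * k - 1\<close> of the \<open>d\<close> colours. Any further vertex
misses only one colour, hence has degree \<open>d - 1\<close>, which is as large as it can be: the remaining vertices form
a complete graph. If \<open>w\<close> had an edge, then \<open>d - 1\<close> would be at least \<open>2 * k - 1\<close>, every vertex would be
adjacent to \<open>w\<close>, and \<open>d\<close> would exceed the order.\<close>
lemma irregular_clique_pair:
  assumes c: "proper c" and w: "w \<in> verts G" "a \<in> miss c w" "b \<in> miss c w" "a \<noteq> b"
  shows "clique_pair G {w} (verts G - {w})"
proof -
  let ?n = "\<lambda>v. {u. {v, u} \<in> edges G}"
  have fin: "finite (verts G)" by (rule finite_verts)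
  have single: "card (miss c v) = 1" if v: "v \<in> verts G" "v \<noteq> w" for v
  proof (rule ccontr)
    assume "card (miss c v) \<noteq> 1"
    moreover have "card (miss c v) \<noteq> 0"
      using card_miss[OF c, of v] degree_less[OF v(1)] by linarith
    ultimately have "card (miss c v) \<noteq> 0" "card (miss c v) \<noteq> Suc 0" by auto
    then obtain p q where pq: "p \<in> miss c v" "q \<in> miss c v" "p \<noteq> q"
      by (metis card_1_singleton_iff card_eq_0_iff ex_in_conv finite_miss insertI1 singletonI subsetI subset_singleton_iff)
    \<comment> \<open>Every colour missing at a third vertex would be missing at \<open>v\<close> and \<open>w\<close>, too.\<close>
    have "\<not> verts G \<subseteq> {v, w}"
      using order k_ge card_mono[of "{v, w}" "verts G"] v(2) by auto
    then obtain u where u: "u \<in> verts G" "u \<noteq> v" "u \<noteq> w" by auto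
    obtain e where "e \<in> miss c u" using c u(1) by (rule ex_miss)
    then have e: "u \<in> unsaturated c e" using u(1) by (simp add: unsaturated_iff)
    then have "v \<in> unsaturated c e" "w \<in> unsaturated c e"
      using misses_all_deficient[OF c v(1) pq] misses_all_deficient[OF c w] by auto
    then show False using unsaturated_subset_pair[OF c _ _ v(2) e] u by auto
  qed
  have deg: "degree G v + 1 = d" if "v \<in> verts G" "v \<noteq> w" for v
    using card_miss[OF c, of v] single[OF that] by linarith
  have "\<exists>a. a \<in> miss c v" if "v \<in> verts G" for v using c that by (blast intro: ex_miss)
  then obtain g where g: "\<And>v. v \<in> verts G \<Longrightarrow> g v \<in> miss c v" by metis
  have gd: "v \<in> unsaturated c (g v)" "w \<in> unsaturated c (g v)" if "v \<in> verts G" for v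
  proof -
    show v: "v \<in> unsaturated c (g v)" using g[OF that] that by (simp add: unsaturated_iff)
    show "w \<in> unsaturated c (g v)" by (rule misses_all_deficient[OF c w]) (use v in blast)
  qed
  have "inj_on g (verts G - {w})"
  proof (rule inj_onI)
    fix u v assume uv: "u \<in> verts G - {w}" "v \<in> verts G - {w}" "g u = g v"
    then have u: "u \<in> verts G" "u \<noteq> w" and v: "v \<in> verts G" "v \<noteq> w" by auto
    have "v \<in> unsaturated c (g u)" using gd(1)[OF v(1)] uv(3) by simp
    then have "v = u \<or> v = w" by (rule unsaturated_subset_pair[OF c gd(1)[OF u(1)] gd(2)[OF u(1)] u(2)])
    then show "u = v" using v(2) by blast
  qed
  moreover have "g ` (verts G - {w}) \<subseteq> miss c w" using gd by (auto simp: unsaturated_def)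
  ultimately have "card (verts G - {w}) \<le> card (miss c w)" by (rule card_inj_on_le) simp
  then have d_ge: "2 * k - 1 + degree G w \<le> d"
    using card_miss[OF c, of w] w(1) order by simp
  have n_sub: "?n v \<subseteq> verts G - {v}" for v using edge_pairD by blast
  have card_n: "card (?n v) = degree G v" for v by (simp add: degree_neighbours)
  have card_V: "card (verts G - {v}) = 2 * k - 1" if "v \<in> verts G" for v using that order by simp
  have fin_n: "finite (?n v)" for v using n_sub fin by (rule finite_subset[OF _ finite_Diff])
  have deg_le: "degree G v \<le> 2 * k - 1" if "v \<in> verts G" for v
    using card_mono[OF _ n_sub[of v]] fin card_n[of v] card_V[OF that] by simp
  have deg_w: "degree G w = 0"
  proof (rule ccontr)
    assume pos: "degree G w \<noteq> 0"
    have "w \<in> ?n v" if v: "v \<in> verts G" "v \<noteq> w" for v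
    proof -
      have "card (verts G - {v}) \<le> card (?n v)"
        using card_V[OF v(1)] card_n[of v] deg[OF v] d_ge pos by linarith
      then have "?n v = verts G - {v}" using n_sub fin by (intro card_seteq) auto
      then show ?thesis using w(1) v(2) by auto
    qed
    then have "verts G - {w} \<subseteq> ?n w" by (auto simp: insert_commute)
    then have "2 * k - 1 \<le> degree G w"
      using card_mono[OF fin_n[of w], of "verts G - {w}"] card_n[of w] card_V[OF w(1)] by simp
    moreover obtain v where "v \<in> verts G" "v \<noteq> w"
    proof -
      have "?n w \<noteq> {}" using pos card_n[of w] by (metis card.empty)
      then show ?thesis using n_sub[of w] that by blast
    qed
    ultimately show False using deg[of v] deg_le[of v] d_ge k_ge by linarith
  qed
  have n_w: "?n w = {}"
    using deg_w card_n[of w] fin_n[of w] by simp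
  have n_v: "?n v = verts G - {w} - {v}" if v: "v \<in> verts G - {w}" for v
  proof (rule card_seteq)
    show "finite (verts G - {w} - {v})" using fin by simp
    show "?n v \<subseteq> verts G - {w} - {v}" using n_sub[of v] n_w by (auto simp: insert_commute)
    have "card (verts G - {w} - {v}) = 2 * k - 2" using v w(1) order fin by simp
    then show "card (verts G - {w} - {v}) \<le> card (?n v)"
      using card_n[of v] deg[of v] d_ge deg_w v k_ge by simp
  qed
  have "edges G = {e. card e = 2 \<and> (e \<subseteq> {w} \<or> e \<subseteq> verts G - {w})}"
  proof (intro equalityI subsetI)
    fix e assume e: "e \<in> edges G"
    have "w \<notin> e"
    proof
      assume "w \<in> e"
      with e obtain u where "e = {w, u}" by (rule edge_other_end)
      then show False using e n_w by auto
    qed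
    then show "e \<in> {e. card e = 2 \<and> (e \<subseteq> {w} \<or> e \<subseteq> verts G - {w})}" using edgeD[OF e] by auto
  next
    fix e assume "e \<in> {e. card e = 2 \<and> (e \<subseteq> {w} \<or> e \<subseteq> verts G - {w})}"
    then have e: "card e = 2" "e \<subseteq> {w} \<or> e \<subseteq> verts G - {w}" by auto
    from e(1) obtain p q where pq: "e = {p, q}" "p \<noteq> q" unfolding card_2_iff by blast
    then have "p \<in> verts G - {w}" "q \<in> verts G - {w} - {p}" using e(2) by auto
    then show "e \<in> edges G" using n_v[of p] pq by auto
  qed
  then show ?thesis using w(1) unfolding clique_pair_def by auto
qed

section \<open>Regular colourings: two complete graphs\<close>

text \<open>Let \<open>v\<close> and \<open>t\<close> be the other vertices missing \<open>a\<close> and \<open>b\<close>. As each of the two colours is still missing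
at no or two vertices after a swap along the chain \<open>K\<close> from \<open>u\<close>, the chain ends in \<open>s\<close> or in \<open>t\<close> but not in \<open>v\<close>.
It cannot end in \<open>t\<close>: after the swap, \<open>u\<close> would need a neighbour missing \<open>a\<close>, and that could only be \<open>v\<close> or
\<open>t\<close>, but \<open>v\<close> misses \<open>a\<close> together with \<open>u\<close>, and \<open>t\<close> misses \<open>b\<close> together with the neighbour \<open>s\<close>. The swap
exchanges \<open>u\<close> for \<open>s\<close> among the vertices missing \<open>a\<close> and keeps the set of edges of
deficient colours.\<close>
lemma kempe_swap_two_deficient:
  assumes c: "proper c"
    and single: "\<forall>w\<in>verts G. \<forall>i\<in>miss c w. \<forall>j\<in>miss c w. i = j"
    and us: "deficient_adj c u s" and a: "a \<in> miss c u" and b: "b \<in> miss c s"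
    and da: "unsaturated c a = {u, v}" "v \<noteq> u"
  obtains c' where "proper c'" "deficient_adj c' = deficient_adj c" "unsaturated c' a = {v, s}"
proof -
  have ab: "a \<noteq> b" using deficient_adj_miss_disjoint[OF c us] a b by auto
  have less: "a < d" "b < d" using a b miss_less by auto
  have "s \<in> unsaturated c b" using b deficient_adjD(4)[OF us] by (simp add: unsaturated_iff)
  with c obtain t where db: "unsaturated c b = {s, t}" "t \<noteq> s" by (rule obtain_unsaturated_pair)
  have ma: "x \<in> {u, v}" if "x \<in> verts G" "a \<in> miss c x" for x using da that by (auto simp: unsaturated_def)
  have mb: "x \<in> {s, t}" if "x \<in> verts G" "b \<in> miss c x" for x using db that by (auto simp: unsaturated_def)
  have V: "u \<in> verts G" "v \<in> verts G" "s \<in> verts G" "t \<in> verts G"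
    using da db by (auto simp: unsaturated_def)
  have m: "a \<in> miss c v" "b \<in> miss c t" using da db by (auto simp: unsaturated_def)
  have distinct: "distinct [u, v, s, t]"
    using da db single[rule_format, OF V(1), of a b] single[rule_format, OF V(2), of a b] a b m ab by auto
  obtain K where K: "u \<in> K" "kempe_closed c a b K"
    "\<And>y z. y \<in> K \<Longrightarrow> z \<in> K \<Longrightarrow> b \<in> miss c y \<Longrightarrow> b \<in> miss c z \<Longrightarrow> y = z"
    using c a by (rule kempe_chain[where b = b]) blast
  define c' where "c' = kempe_swap c a b K"
  have c': "proper c'" unfolding c'_def by (rule proper_kempe_swap[OF c K(2) less])
  note miss' = miss_kempe_swap[OF K(2) less, folded c'_def]
  have da': "unsaturated c' a = ({v} - K) \<union> ({s, t} \<inter> K)"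
    using ma mb a b m V K(1) by (auto simp: unsaturated_def miss')
  have db': "unsaturated c' b = ({s, t} - K) \<union> ({u, v} \<inter> K)"
    using ma mb a b m V K(1) by (auto simp: unsaturated_def miss')
  have "s \<in> K \<or> t \<in> K"
  proof (rule ccontr)
    assume none: "\<not> ?thesis"
    have "v \<in> K"
    proof (rule ccontr)
      assume "v \<notin> K"
      then have "unsaturated c' a = {v}" using da' none by auto
      then show False using card_unsaturated[OF c' less(1)] by simp
    qed
    then have "unsaturated c' b = {u, v, s, t}" using db' none K(1) by auto
    then show False using card_unsaturated_le[OF c', of b] distinct by simp
  qed
  then obtain r where r: "{s, t} \<inter> K = {r}" using K(3)[of s t] b m(2) db(2) by auto
  have "v \<notin> K"
  proof
    assume "v \<in> K"
    then have "unsaturated c' a = {r}" using da' r by auto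
    then show False using card_unsaturated[OF c' less(1)] by simp
  qed
  then have da'': "unsaturated c' a = {v, r}" using da' r by auto
  have ne: "unsaturated c' e \<noteq> {} \<longleftrightarrow> unsaturated c e \<noteq> {}" if "e \<noteq> a" "e \<noteq> b" for e
    using that by (simp add: unsaturated_def miss')
  have ne_a: "unsaturated c' a \<noteq> {}" "unsaturated c a \<noteq> {}" using da'' da by auto
  have ne_b: "unsaturated c' b \<noteq> {}" "unsaturated c b \<noteq> {}" using db' db K(1) by auto
  have "unsaturated c' (c' e) \<noteq> {} \<longleftrightarrow> unsaturated c (c e) \<noteq> {}" for e
  proof -
    consider "c e = a" | "c e = b" | "c e \<noteq> a" "c e \<noteq> b" by blast
    then show ?thesis
    proof cases
      case 3
      then have "c' e = c e" by (simp add: c'_def kempe_swap_def)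
      then show ?thesis using ne 3 by simp
    qed (use ne_a ne_b in \<open>auto simp: c'_def kempe_swap_def\<close>)
  qed
  then have deficient_adj': "deficient_adj c' = deficient_adj c" by (simp add: deficient_adj_def fun_eq_iff)
  have "r = s"
  proof (rule ccontr)
    assume "r \<noteq> s"
    then have "r = t" using r by auto
    have "b \<notin> miss c u" using single[rule_format, OF V(1) a] ab by auto
    then have "a \<notin> miss c' u" using K(1) by (simp add: miss')
    with c' ne_a(1) obtain y where y: "deficient_adj c' u y" "a \<in> miss c' y" by (rule ex_deficient_adj_missing)
    then have uy: "deficient_adj c u y" using deficient_adj' by simp
    have "y \<in> {v, t}" using y(2) deficient_adjD(4)[OF uy] da'' \<open>r = t\<close> by (auto simp: unsaturated_def)
    then show False
      using deficient_adj_miss_disjoint[OF c uy] a m(1) deficient_adj_missing_unique[OF c uy us _ b] m(2) db(2) by auto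
  qed
  then show ?thesis using that[OF c' deficient_adj'] da'' by simp
qed

text \<open>Let \<open>a\<close> be the colour missing at \<open>u\<close>, and \<open>v\<close> the other vertex missing it. After the swap of
\<open>kempe_swap_two_deficient\<close> it is missing at \<open>v\<close> and \<open>s\<close> instead, so \<open>x\<close> has one of these two as a
neighbour along a deficient colour. It is not \<open>v\<close>, since \<open>x\<close> has only one neighbour that misses \<open>a\<close> in the old colouring, and this is \<open>u\<close>.\<close>
lemma deficient_adj_trans:
  assumes c: "proper c"
    and single: "\<forall>w\<in>verts G. \<forall>i\<in>miss c w. \<forall>j\<in>miss c w. i = j"
    and xu: "deficient_adj c x u" and us: "deficient_adj c u s" and "x \<noteq> s"
  shows "deficient_adj c x s"
proof -
  have ux: "deficient_adj c u x" using xu by (simp add: deficient_adj_commute)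
  obtain a where a: "a \<in> miss c u" using c deficient_adjD(3)[OF us] by (rule ex_miss)
  obtain b where b: "b \<in> miss c s" using c deficient_adjD(4)[OF us] by (rule ex_miss)
  have "u \<in> unsaturated c a" using a deficient_adjD(3)[OF us] by (simp add: unsaturated_iff)
  with c obtain v where da: "unsaturated c a = {u, v}" "v \<noteq> u" by (rule obtain_unsaturated_pair)
  obtain c' where c': "proper c'" "deficient_adj c' = deficient_adj c" "unsaturated c' a = {v, s}"
    using c single us a b da by (rule kempe_swap_two_deficient)
  have mv: "a \<in> miss c v" using da by (auto simp: unsaturated_def)
  have "x \<noteq> v" using deficient_adj_miss_disjoint[OF c ux] a mv by auto
  then have "x \<notin> unsaturated c' a" using c'(3) \<open>x \<noteq> s\<close> by auto
  then have "a \<notin> miss c' x" using deficient_adjD(3)[OF xu] by (simp add: unsaturated_iff)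
  moreover have "unsaturated c' a \<noteq> {}" using c'(3) by simp
  ultimately obtain y where y: "deficient_adj c' x y" "a \<in> miss c' y"
    using c'(1) by (blast elim: ex_deficient_adj_missing)
  then have xy: "deficient_adj c x y" using c'(2) by simp
  have "y \<in> {v, s}" using c'(3) y(2) deficient_adjD(4)[OF xy] by (auto simp: unsaturated_def)
  moreover have "y \<noteq> v" using deficient_adj_missing_unique[OF c xy xu _ a] mv da(2) by auto
  ultimately show ?thesis using xy by auto
qed

text \<open>Let \<open>u\<close> and \<open>v\<close> miss the same colour. Every other vertex is adjacent, along deficient
colours, to exactly one of them, so their closed neighbourhoods partition the graph, and by transitivity these are complete. Adjacent vertices miss
different colours; hence each of the two vertices missing a colour lies in a different part.\<close>
lemma two_cliques:
  assumes c: "proper c"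
    and single: "\<forall>w\<in>verts G. \<forall>i\<in>miss c w. \<forall>j\<in>miss c w. i = j"
  obtains U W m where "verts G = U \<union> W" "U \<inter> W = {}"
    "\<forall>x y. deficient_adj c x y \<longleftrightarrow> x \<noteq> y \<and> (x \<in> U \<and> y \<in> U \<or> x \<in> W \<and> y \<in> W)"
    "\<forall>v\<in>verts G. miss c v = {m v}"
    "bij_betw m U {a. unsaturated c a \<noteq> {}}" "bij_betw m W {a. unsaturated c a \<noteq> {}}"
proof -
  define m where "m v = (SOME a. a \<in> miss c v)" for v
  have m: "miss c v = {m v}" if v: "v \<in> verts G" for v
  proof -
    obtain a where a: "a \<in> miss c v" using c v by (rule ex_miss)
    then have "m v \<in> miss c v" unfolding m_def by (rule someI)
    then show ?thesis using single[rule_format, OF v] by auto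
  qed
  have "verts G \<noteq> {}" using order k_ge by auto
  then obtain u where u: "u \<in> verts G" by blast
  have "u \<in> unsaturated c (m u)" using m[OF u] u by (simp add: unsaturated_iff)
  with c obtain v where da: "unsaturated c (m u) = {u, v}" "v \<noteq> u" by (rule obtain_unsaturated_pair)
  have v: "v \<in> verts G" "m u \<in> miss c v" using da by (auto simp: unsaturated_def)
  define B where "B x = insert x {y. deficient_adj c x y}" for x
  have B_clique: "deficient_adj c y z" if "y \<in> B x" "z \<in> B x" "y \<noteq> z" for x y z
    using that deficient_adj_trans[OF c single, of y x z] by (auto simp: B_def deficient_adj_commute)
  have B_closed: "z \<in> B x" if "y \<in> B x" "deficient_adj c y z" for x y z
    using that deficient_adj_trans[OF c single, of x y z] by (auto simp: B_def)
  have uv: "\<not> deficient_adj c u v" using deficient_adj_miss_disjoint[OF c, of u v] v(2) m[OF u] by auto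
  have disj: "B u \<inter> B v = {}"
  proof (rule ccontr)
    assume "B u \<inter> B v \<noteq> {}"
    then obtain x where x: "x \<in> B u" "x \<in> B v" by blast
    then have "deficient_adj c x u" "deficient_adj c x v" using uv da(2) by (auto simp: B_def deficient_adj_commute)
    then show False using deficient_adj_missing_unique[OF c, of x u v "m u"] v(2) m[OF u] da(2) by auto
  qed
  have union: "verts G = B u \<union> B v"
  proof (intro equalityI subsetI)
    fix x assume x: "x \<in> verts G"
    show "x \<in> B u \<union> B v"
    proof (cases "x \<in> {u, v}")
      case False
      then have "m u \<notin> miss c x" using da x by (auto simp: unsaturated_def)
      moreover have "unsaturated c (m u) \<noteq> {}" using da(1) by simp
      ultimately obtain y where "deficient_adj c x y" "m u \<in> miss c y"
        using c by (blast elim: ex_deficient_adj_missing)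
      moreover from this have "y \<in> {u, v}" using da(1) deficient_adjD(4) by (auto simp: unsaturated_def)
      ultimately show ?thesis by (auto simp: B_def deficient_adj_commute)
    qed (auto simp: B_def)
  qed (use u v deficient_adjD in \<open>auto simp: B_def\<close>)
  have deficient_adj_iff: "deficient_adj c x y \<longleftrightarrow> x \<noteq> y \<and> (x \<in> B u \<and> y \<in> B u \<or> x \<in> B v \<and> y \<in> B v)" for x y
    using B_clique B_closed union deficient_adjD by blast
  have inj: "inj_on m (B x)" if "x \<in> {u, v}" for x
  proof (rule inj_onI, rule ccontr)
    fix y z assume yz: "y \<in> B x" "z \<in> B x" "m y = m z" "y \<noteq> z"
    have "deficient_adj c y z" using B_clique yz by blast
    then show False using deficient_adj_miss_disjoint[OF c] m deficient_adjD yz(3) by fastforce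
  qed
  have image: "m ` B x = {a. unsaturated c a \<noteq> {}}" if x: "x \<in> {u, v}" for x
  proof (intro equalityI subsetI)
    fix a assume "a \<in> m ` B x"
    then obtain y where "y \<in> B x" "a = m y" by blast
    moreover from this have "y \<in> verts G" using union x by auto
    ultimately have "y \<in> unsaturated c a" using m by (simp add: unsaturated_iff)
    then show "a \<in> {a. unsaturated c a \<noteq> {}}" by blast
  next
    fix a assume "a \<in> {a. unsaturated c a \<noteq> {}}"
    then obtain y where "y \<in> unsaturated c a" by blast
    with c obtain z where yz: "unsaturated c a = {y, z}" "z \<noteq> y" by (rule obtain_unsaturated_pair)
    then have V: "y \<in> verts G" "z \<in> verts G" and "a \<in> miss c y" "a \<in> miss c z"
      by (auto simp: unsaturated_def)
    then have a: "m y = a" "m z = a" using m by auto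
    have "y \<in> B x \<or> z \<in> B x"
    proof (rule ccontr)
      assume *: "\<not> ?thesis"
      obtain x' where x': "x' \<in> {u, v}" "verts G = B x \<union> B x'" using x union by auto
      then have "y \<in> B x'" "z \<in> B x'" using * V by auto
      then show False using inj_onD[OF inj[OF x'(1)]] a yz(2) by metis
    qed
    then show "a \<in> m ` B x" using a by (metis imageI)
  qed
  show ?thesis using that[of "B u" "B v" m] union disj deficient_adj_iff m inj image by (simp add: bij_betw_def)
qed

text \<open>A colour \<open>p\<close> missing nowhere gives a perfect matching between \<open>U\<close> and \<open>W\<close>. Let \<open>h\<close> map each vertex of \<open>W\<close> to its
partner in \<open>U\<close> and fix \<open>U\<close>. Colouring the edges inside \<open>W\<close> like their images under \<open>h\<close> makes every
\<open>y\<close> in \<open>W\<close> miss the colour missing at \<open>h y\<close>. That colour is then free at both ends of the edge of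
colour \<open>p\<close> at \<open>y\<close>, and giving it to this edge, for all \<open>y\<close> at once, leaves no edge of colour \<open>p\<close>.\<close>
lemma no_perfect_colour:
  assumes c: "proper c"
    and single: "\<forall>w\<in>verts G. \<forall>i\<in>miss c w. \<forall>j\<in>miss c w. i = j"
    and p: "p < d"
  shows "unsaturated c p \<noteq> {}"
proof
  assume perfect: "unsaturated c p = {}"
  obtain U W m where UW: "verts G = U \<union> W" "U \<inter> W = {}"
    and deficient_adj': "\<forall>x y. deficient_adj c x y \<longleftrightarrow> x \<noteq> y \<and> (x \<in> U \<and> y \<in> U \<or> x \<in> W \<and> y \<in> W)"
    and m': "\<forall>v\<in>verts G. miss c v = {m v}"
    and "bij_betw m U {a. unsaturated c a \<noteq> {}}" "bij_betw m W {a. unsaturated c a \<noteq> {}}"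
    using c single by (rule two_cliques)
  note deficient_adj_iff = deficient_adj'[rule_format] and m = m'[rule_format]
  have unsaturated_m: "unsaturated c (m v) \<noteq> {}" if "v \<in> verts G" for v
    using m[OF that] that by (auto simp: unsaturated_def)
  have across: "x \<in> U \<longleftrightarrow> y \<notin> U" if e: "{x, y} \<in> edges G" "unsaturated c (c {x, y}) = {}" for x y
  proof -
    have "\<not> deficient_adj c x y" using e by (simp add: deficient_adj_def)
    then show ?thesis using edge_pairD[OF e(1)] deficient_adj_iff UW by blast
  qed
  have "\<exists>y. {x, y} \<in> edges G \<and> c {x, y} = p" if x: "x \<in> verts G" for x
  proof -
    have "p \<notin> miss c x" using perfect x by (auto simp: unsaturated_def)
    with p show ?thesis by (rule ex_neighbour_of_colour) blast
  qed
  then obtain q where q: "\<And>x. x \<in> verts G \<Longrightarrow> {x, q x} \<in> edges G \<and> c {x, q x} = p" by metis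
  have q_eq: "q x = y" if "{x, y} \<in> edges G" "c {x, y} = p" for x y
    using proper_at_pair[OF c, of x "q x" y] q[OF edge_pairD(2)[OF that(1)]] that by simp
  define h where "h x = (if x \<in> U then x else q x)" for x
  have hU: "h x \<in> U" if "x \<in> verts G" for x
    using that q[OF that] across[of x "q x"] perfect by (auto simp: h_def)
  have h_inj: "h x \<noteq> h y" if "deficient_adj c x y" for x y
  proof
    assume eq: "h x = h y"
    show False
    proof (cases "x \<in> U")
      case True
      then show False using eq that deficient_adj_iff UW by (auto simp: h_def)
    next
      case False
      then have W: "x \<in> W" "y \<in> W" "y \<notin> U" using that deficient_adj_iff UW by auto
      then have "x \<in> verts G" "y \<in> verts G" using UW by auto
      then have "{q x, x} \<in> edges G" "c {q x, x} = p" "{q x, y} \<in> edges G" "c {q x, y} = p"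
        using q[of x] q[of y] eq False W by (auto simp: h_def insert_commute)
      then have "x = y" using proper_at_pair[OF c] by metis
      then show False using that deficient_adjD(2) by blast
    qed
  qed
  have h_deficient_adj: "deficient_adj c (h x) (h y)" if "deficient_adj c x y" for x y
    using h_inj[OF that] hU deficient_adjD[OF that] deficient_adj_iff by blast
  have h_p: "h x = h y" if "{x, y} \<in> edges G" "c {x, y} = p" for x y
    using that across[of x y] perfect q_eq[of x y] q_eq[of y x] by (auto simp: h_def insert_commute)
  \<comment> \<open>An edge of colour \<open>p\<close> is collapsed by \<open>h\<close> to its end in \<open>U\<close>.\<close>
  define c' where "c' e = (if c e = p then m (the_elem (h ` e))
    else if unsaturated c (c e) \<noteq> {} then c (h ` e) else c e)" for e
  have c'_p: "c' {x, y} = m (h x)" if "{x, y} \<in> edges G" "c {x, y} = p" for x y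
    using that h_p[OF that] by (simp add: c'_def)
  have c'_d: "c' {x, y} = c {h x, h y}" if "deficient_adj c x y" for x y
    using that perfect by (auto simp: c'_def deficient_adj_def)
  have c'_o: "c' {x, y} = c {x, y}" if "c {x, y} \<noteq> p" "\<not> deficient_adj c x y" "{x, y} \<in> edges G" for x y
    using that by (auto simp: c'_def deficient_adj_def)
  have hV: "h x \<in> verts G" if "x \<in> verts G" for x using hU[OF that] UW by auto
  have def': "unsaturated c (c' {x, y}) \<noteq> {} \<longleftrightarrow> c {x, y} = p \<or> deficient_adj c x y" "c' {x, y} \<noteq> p" "c' {x, y} < d"
    if e: "{x, y} \<in> edges G" for x y
  proof -
    note V = edge_pairD(2,3)[OF e]
    consider "c {x, y} = p" | "deficient_adj c x y" | "c {x, y} \<noteq> p" "\<not> deficient_adj c x y" by blast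
    then have "(unsaturated c (c' {x, y}) \<noteq> {} \<longleftrightarrow> c {x, y} = p \<or> deficient_adj c x y) \<and> c' {x, y} \<noteq> p \<and> c' {x, y} < d"
    proof cases
      case 1
      have "unsaturated c (m (h x)) \<noteq> {}" by (rule unsaturated_m[OF hV[OF V(1)]])
      then show ?thesis using c'_p[OF e 1] 1 perfect unsaturated_less by auto
    next
      case 2
      then have "unsaturated c (c {h x, h y}) \<noteq> {}" using h_deficient_adj by (simp add: deficient_adj_def)
      then show ?thesis using c'_d[OF 2] 2 perfect unsaturated_less by auto
    next
      case 3
      then show ?thesis using c'_o[OF 3 e] e proper_less[OF c e] by (auto simp: deficient_adj_def)
    qed
    then show "unsaturated c (c' {x, y}) \<noteq> {} \<longleftrightarrow> c {x, y} = p \<or> deficient_adj c x y" "c' {x, y} \<noteq> p" "c' {x, y} < d"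
      by auto
  qed
  have mixed: False if "{x, y} \<in> edges G" "c {x, y} = p" "deficient_adj c x z" "c' {x, y} = c' {x, z}" for x y z
  proof -
    have "c {h x, h z} \<notin> miss c (h x)" by (rule not_miss_self(1)[OF deficient_adjD(1)[OF h_deficient_adj[OF that(3)]]])
    then show False
      using m[OF hV[OF deficient_adjD(3)[OF that(3)]]] c'_p[OF that(1,2)] c'_d[OF that(3)] that(4) by auto
  qed
  have "proper c'"
  proof (rule properI_pair)
    show "c' e < d" if e: "e \<in> edges G" for e
    proof -
      obtain x y where "e = {x, y}" using edgeD(2)[OF e] unfolding card_2_iff by blast
      then show ?thesis using def'(3) e by blast
    qed
    fix x y z assume e: "{x, y} \<in> edges G" "{x, z} \<in> edges G" and eq: "c' {x, y} = c' {x, z}"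
    then have iff: "c {x, y} = p \<or> deficient_adj c x y \<longleftrightarrow> c {x, z} = p \<or> deficient_adj c x z"
      using def'(1)[OF e(1)] def'(1)[OF e(2)] by simp
    consider "c {x, y} = p" "c {x, z} = p" | "c {x, y} = p" "deficient_adj c x z" | "deficient_adj c x y" "c {x, z} = p"
      | "deficient_adj c x y" "deficient_adj c x z"
      | "c {x, y} \<noteq> p" "\<not> deficient_adj c x y" "c {x, z} \<noteq> p" "\<not> deficient_adj c x z"
      using iff by blast
    then show "y = z"
    proof cases
      case 1
      then show ?thesis using proper_at_pair[OF c e] by simp
    next
      case 2
      then show ?thesis using mixed[OF e(1)] eq by blast
    next
      case 3
      then show ?thesis using mixed[OF e(2)] eq by metis
    next
      case 4
      then have "c {h x, h y} = c {h x, h z}" using c'_d eq by simp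
      then have "h y = h z"
        using proper_at_pair[OF c deficient_adjD(1)[OF h_deficient_adj[OF 4(1)]] deficient_adjD(1)[OF h_deficient_adj[OF 4(2)]]] by simp
      moreover have "y = z \<or> deficient_adj c y z" using 4 deficient_adj_iff UW by blast
      ultimately show ?thesis using h_inj by blast
    next
      case 5
      then show ?thesis using proper_at_pair[OF c e] c'_o e eq by simp
    qed
  qed
  moreover have "p \<in> miss c' x" for x
  proof -
    have "c' e \<noteq> p" if e: "e \<in> edges G" for e
    proof -
      obtain x y where "e = {x, y}" using edgeD(2)[OF e] unfolding card_2_iff by blast
      then show ?thesis using def'(2) e by blast
    qed
    then show ?thesis using p by (simp add: miss_def)
  qed
  then have "unsaturated c' p = verts G" by (auto simp: unsaturated_def)
  ultimately show False using card_unsaturated_le[of c' p] order k_ge by auto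
qed

text \<open>All colours are deficient now, so the two complete graphs contain all edges. The edges in \<open>U\<close> of the
colour missing at a vertex \<open>u\<close> of \<open>U\<close> pair off the remaining vertices of \<open>U\<close>.\<close>
lemma regular_clique_pair:
  assumes c: "proper c"
    and single: "\<forall>w\<in>verts G. \<forall>i\<in>miss c w. \<forall>j\<in>miss c w. i = j"
  obtains U W where "clique_pair G U W" "card U = card W" "odd (card U)"
proof -
  obtain U W m where UW: "verts G = U \<union> W" "U \<inter> W = {}"
    and deficient_adj': "\<forall>x y. deficient_adj c x y \<longleftrightarrow> x \<noteq> y \<and> (x \<in> U \<and> y \<in> U \<or> x \<in> W \<and> y \<in> W)"
    and m': "\<forall>v\<in>verts G. miss c v = {m v}"
    and bij: "bij_betw m U {a. unsaturated c a \<noteq> {}}" "bij_betw m W {a. unsaturated c a \<noteq> {}}"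
    using c single by (rule two_cliques)
  note deficient_adj_iff = deficient_adj'[rule_format] and m = m'[rule_format]
  have card: "card U = card W" using bij bij_betw_same_card by metis
  have edge_iff: "{x, y} \<in> edges G \<longleftrightarrow> deficient_adj c x y" for x y
    using no_perfect_colour[OF c single] proper_less[OF c] by (auto simp: deficient_adj_def)
  have edges: "edges G = {e. card e = 2 \<and> (e \<subseteq> U \<or> e \<subseteq> W)}"
  proof (intro equalityI subsetI)
    fix e assume e: "e \<in> edges G"
    then obtain x y where xy: "e = {x, y}" using edgeD(2)[OF e] unfolding card_2_iff by blast
    then show "e \<in> {e. card e = 2 \<and> (e \<subseteq> U \<or> e \<subseteq> W)}"
      using edgeD(2)[OF e] e edge_iff deficient_adj_iff by auto
  next
    fix e assume "e \<in> {e. card e = 2 \<and> (e \<subseteq> U \<or> e \<subseteq> W)}"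
    then have e: "card e = 2" "e \<subseteq> U \<or> e \<subseteq> W" by auto
    from e(1) obtain x y where "e = {x, y}" "x \<noteq> y" unfolding card_2_iff by blast
    then show "e \<in> edges G" using e(2) edge_iff deficient_adj_iff by auto
  qed
  have "card U + card W = 2 * k"
    using order UW finite_verts card_Un_disjoint[of U W] by auto
  then have "U \<noteq> {}" using card k_ge by auto
  then obtain u where u: "u \<in> U" by blast
  let ?S = "{e \<in> edges G. c e = m u \<and> e \<subseteq> U}"
  have "\<Union>?S = U - {u}"
  proof (intro equalityI subsetI)
    fix x assume "x \<in> \<Union>?S"
    then obtain e where e: "e \<in> edges G" "c e = m u" "e \<subseteq> U" "x \<in> e" by blast
    then have "u \<notin> e" using m[of u] u UW missD[of "m u" c u e] by auto
    then show "x \<in> U - {u}" using e by auto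
  next
    fix x assume x: "x \<in> U - {u}"
    then have "m x \<noteq> m u" using bij(1) u by (auto simp: bij_betw_def dest: inj_onD)
    then have "m u \<notin> miss c x" using m[of x] x UW by auto
    moreover have "m u < d" using m[of u] u UW miss_less[of "m u" c u] by auto
    ultimately obtain y where y: "{x, y} \<in> edges G" "c {x, y} = m u"
      by (blast elim: ex_neighbour_of_colour)
    then have "y \<in> U" using edge_iff deficient_adj_iff x UW by blast
    then show "x \<in> \<Union>?S" using y x by blast
  qed
  moreover have "card (\<Union>?S) = 2 * card ?S"
  proof (rule even_card_Union_of_pairs)
    show "finite ?S" using finite_edge_set by auto
    show "e \<inter> f = {}" if "e \<in> ?S" "f \<in> ?S" "e \<noteq> f" for e f
      using that proper_at[OF c, of e f] by fastforce
  qed (auto dest: edgeD)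
  ultimately have "even (card (U - {u}))" by simp
  moreover have "finite U" using finite_verts UW by auto
  ultimately have "odd (card U)" using u by (metis card_Suc_Diff1 even_Suc)
  then show ?thesis using that card edges UW unfolding clique_pair_def by blast
qed

end

section \<open>Chromatic index and edge stability\<close>

lemma chromatic_index_le: "proper_edge_colouring G j c \<Longrightarrow> chromatic_index G \<le> j"
  unfolding chromatic_index_def by (rule Least_le) blast

lemma chromatic_index_colouring:
  assumes "simple_graph G"
  obtains c where "proper_edge_colouring G (chromatic_index G) c"
proof -
  have "\<exists>c. proper_edge_colouring G (chromatic_index G) c"
    unfolding chromatic_index_def by (rule LeastI_ex[OF proper_edge_colouring_exists[OF assms]])
  then show ?thesis using that by blast
qed

lemma chromatic_edge_stability_index_le:
  assumes "F \<subseteq> edges G" "chromatic_index (delete_edges G F) < chromatic_index G"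
  shows "chromatic_edge_stability_index G \<le> card F"
  unfolding chromatic_edge_stability_index_def by (rule Least_le) (use assms in blast)

lemma chromatic_edge_stability_index_witness:
  assumes "simple_graph G" "edges G \<noteq> {}"
  obtains F where "F \<subseteq> edges G" "card F = chromatic_edge_stability_index G"
    "chromatic_index (delete_edges G F) < chromatic_index G"
proof -
  have "\<exists>F. F \<subseteq> edges G \<and> card F = chromatic_edge_stability_index G \<and>
    chromatic_index (delete_edges G F) < chromatic_index G"
    unfolding chromatic_edge_stability_index_def
    by (rule LeastI_ex) (use edge_stability_witness[OF assms] in blast)
  then show ?thesis using that by blast
qed

lemma chromatic_edge_stability_index_pos:
  assumes "simple_graph G" "edges G \<noteq> {}" shows "0 < chromatic_edge_stability_index G"
proof (rule ccontr)
  assume *: "\<not> ?thesis"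
  obtain F where F: "F \<subseteq> edges G" "card F = chromatic_edge_stability_index G"
    "chromatic_index (delete_edges G F) < chromatic_index G"
    using assms by (rule chromatic_edge_stability_index_witness)
  then have "F = {}" using * finite_edges[OF assms(1)] by (auto dest: finite_subset)
  moreover have "delete_edges G {} = G" by (simp add: delete_edges_def)
  ultimately show False using F(3) by simp
qed

text \<open>After the class of \<open>a\<close> is deleted, exchanging \<open>a\<close> with the largest colour saves that colour.\<close>
lemma chromatic_edge_stability_index_le_class:
  assumes c: "proper_edge_colouring G (chromatic_index G) c" and a: "a < chromatic_index G"
  shows "chromatic_edge_stability_index G \<le> card {e \<in> edges G. c e = a}"
proof (rule chromatic_edge_stability_index_le)
  let ?F = "{e \<in> edges G. c e = a}" and ?t = "transpose a (chromatic_index G - 1)"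
  have "proper_edge_colouring (delete_edges G ?F) (chromatic_index G - 1) (?t \<circ> c)"
    unfolding proper_edge_colouring_def
  proof (intro conjI ballI impI)
    fix e assume "e \<in> edges (delete_edges G ?F)"
    then have "c e \<noteq> a" "c e < chromatic_index G"
      using c by (auto simp: delete_edges_def proper_edge_colouring_def)
    then show "(?t \<circ> c) e < chromatic_index G - 1" using a by (auto simp: transpose_def)
  next
    fix e f assume "e \<in> edges (delete_edges G ?F)" "f \<in> edges (delete_edges G ?F)" "e \<noteq> f" "e \<inter> f \<noteq> {}"
    then have "c e \<noteq> c f" using c by (auto simp: delete_edges_def proper_edge_colouring_def)
    then show "(?t \<circ> c) e \<noteq> (?t \<circ> c) f" by (auto dest: transpose_eq_imp_eq)
  qed
  then show "chromatic_index (delete_edges G ?F) < chromatic_index G"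
    using chromatic_index_le a by fastforce
qed auto

lemma degree_le_max_degree:
  "simple_graph G \<Longrightarrow> v \<in> verts G \<Longrightarrow> degree G v \<le> max_degree G"
  by (simp add: max_degree_def simple_graph_def)

text \<open>Some colour is missing at some vertex, so its class is not a perfect matching.\<close>
lemma class2_edge_stability_upper_bound:
  assumes G: "simple_graph G" "edges G \<noteq> {}" and order: "card (verts G) = 2 * k" and "class2 G"
  shows "chromatic_edge_stability_index G \<le> k - 1"
proof -
  interpret palette G "chromatic_index G" by unfold_locales (rule G(1))
  obtain c where c: "proper c" using G(1) by (rule chromatic_index_colouring)
  obtain e where "e \<in> edges G" using G(2) by blast
  then have "e \<subseteq> verts G" "e \<noteq> {}" using edgeD[of e] by auto
  then obtain v where v: "v \<in> verts G" by blast
  have "degree G v < chromatic_index G"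
    using degree_le_max_degree[OF G(1) v] \<open>class2 G\<close> by (simp add: class2_def)
  then have "card (miss c v) \<noteq> 0" using card_miss[OF c, of v] by linarith
  then obtain a where a: "a \<in> miss c v" by fastforce
  then have "v \<in> unsaturated c a" using v by (simp add: unsaturated_iff)
  then have "card (unsaturated c a) \<noteq> 0" by auto
  then have "card {e \<in> edges G. c e = a} \<le> k - 1"
    using card_unsaturated_class[OF c miss_less[OF a]] order by linarith
  then show ?thesis
    using chromatic_edge_stability_index_le_class[OF c miss_less[OF a]] by linarith
qed

lemma extremal_clique_pair:
  assumes G: "simple_graph G" "edges G \<noteq> {}" and order: "card (verts G) = 2 * k" and "class2 G"
    and es: "chromatic_edge_stability_index G = k - 1"
  obtains U W where "clique_pair G U W" "card U = 1 \<or> odd (card U) \<and> 2 \<le> card U \<and> card U = card W"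
proof -
  have k: "2 \<le> k" using chromatic_edge_stability_index_pos[OF G] es by linarith
  interpret tight_graph G "chromatic_index G" k
  proof unfold_locales
    show "degree G v < chromatic_index G" if "v \<in> verts G" for v
      using degree_le_max_degree[OF G(1) that] \<open>class2 G\<close> by (simp add: class2_def)
    show "k - 1 \<le> card {e \<in> edges G. c e = a}"
      if "proper_edge_colouring G (chromatic_index G) c" "a < chromatic_index G" for c a
      using chromatic_edge_stability_index_le_class[OF that] es by simp
  qed (use G order k in auto)
  obtain c where c: "proper c" using G(1) by (rule chromatic_index_colouring)
  show ?thesis
  proof (cases "\<forall>w\<in>verts G. \<forall>i\<in>miss c w. \<forall>j\<in>miss c w. i = j")
    case True
    with c obtain U W where UW: "clique_pair G U W" "card U = card W" "odd (card U)"
      by (rule regular_clique_pair)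
    moreover have "card U + card W = 2 * k"
      using order UW(1) finite_verts card_Un_disjoint[of U W] by (auto simp: clique_pair_def)
    ultimately show ?thesis using that k by auto
  next
    case False
    then obtain w i j where "w \<in> verts G" "i \<in> miss c w" "j \<in> miss c w" "i \<noteq> j" by blast
    from irregular_clique_pair[OF c this] show ?thesis by (rule that) simp
  qed
qed

section \<open>Two disjoint complete graphs of odd order\<close>

lemma odd_matching_bound:
  assumes "finite U" "odd (card U)" "finite M" "\<And>e. e \<in> M \<Longrightarrow> card e = 2" "\<And>e. e \<in> M \<Longrightarrow> e \<subseteq> U"
    and "\<And>e f. e \<in> M \<Longrightarrow> f \<in> M \<Longrightarrow> e \<noteq> f \<Longrightarrow> e \<inter> f = {}"
  shows "2 * card M + 1 \<le> card U"
proof -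
  have "card (\<Union>M) = 2 * card M" using assms(3,4,6) by (rule even_card_Union_of_pairs)
  moreover have "card (\<Union>M) \<le> card U" using assms(1,5) by (intro card_mono) auto
  ultimately show ?thesis using assms(2) by (metis dvd_triv_left le_neq_implies_less less_eq_Suc_le Suc_eq_plus1)
qed

text \<open>Each colour class of the graph that remains has at most \<open>k - 1\<close> edges because it leaves a vertex uncovered
in each of the two odd complete graphs. On the other hand \<open>d\<close> is at most the order of the larger one,
and in both cases for the sizes this makes the number of edges at least \<open>d * (k - 1)\<close>.\<close>
lemma clique_pair_edge_stability:
  assumes G: "simple_graph G" "edges G \<noteq> {}" and order: "card (verts G) = 2 * k" and "class2 G"
    and UW: "clique_pair G U W" and odd: "odd (card U)" "odd (card W)"
    and sizes: "card U = 1 \<or> card U = card W"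
  shows "k - 1 \<le> chromatic_edge_stability_index G"
proof -
  interpret palette G 0 by unfold_locales (rule G(1))
  define d where "d = chromatic_index G"
  have V: "verts G = U \<union> W" "U \<inter> W = {}" and E: "edges G = {e. card e = 2 \<and> (e \<subseteq> U \<or> e \<subseteq> W)}"
    using UW by (auto simp: clique_pair_def)
  have fin: "finite U" "finite W" using finite_verts V(1) by auto
  have cards: "card U + card W = 2 * k" using order V fin by (simp add: card_Un_disjoint)
  have deg: "degree G v + 1 \<le> max (card U) (card W)" if v: "v \<in> verts G" for v
  proof -
    have "degree G v + 1 \<le> card X" if X: "X \<in> {U, W}" "v \<in> X" for X
    proof -
      have "{u. {v, u} \<in> edges G} \<subseteq> X - {v}" using X V by (auto simp: E)
      then have "degree G v \<le> card (X - {v})"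
        unfolding degree_neighbours using X fin by (intro card_mono) auto
      moreover have "card (X - {v}) + 1 = card X" using X fin card_Suc_Diff1[of X v] by auto
      ultimately show ?thesis by linarith
    qed
    then show ?thesis using v V(1) by fastforce
  qed
  have "verts G \<noteq> {}" using odd V by auto
  then have "max_degree G \<in> degree G ` verts G"
    unfolding max_degree_def using finite_verts by (intro Max_in) auto
  then have d_le: "d \<le> max (card U) (card W)" and d_pos: "0 < d"
    using deg \<open>class2 G\<close> by (auto simp: d_def class2_def)
  have "card (edges G) = (card U choose 2) + (card W choose 2)"
  proof -
    have "edges G = {e. e \<subseteq> U \<and> card e = 2} \<union> {e. e \<subseteq> W \<and> card e = 2}" by (auto simp: E)
    moreover have "{e. e \<subseteq> U \<and> card e = 2} \<inter> {e. e \<subseteq> W \<and> card e = 2} = {}"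
      using V(2) by (auto simp: card_2_iff)
    ultimately show ?thesis using fin by (simp add: card_Un_disjoint n_subsets)
  qed
  then have edges_ge: "d * (k - 1) \<le> card (edges G)"
  proof -
    obtain i j where ij: "card U = 2 * i + 1" "card W = 2 * j + 1" using odd by (auto elim!: oddE)
    then have k: "k - 1 = i + j" using cards by simp
    have "d \<le> card W" using d_le sizes ij by auto
    then have "d * (k - 1) \<le> card W * (i + j)" unfolding k by simp
    also have "\<dots> \<le> (card U choose 2) + (card W choose 2)"
      using sizes ij by (auto simp: choose_two algebra_simps)
    finally show ?thesis using \<open>card (edges G) = _\<close> by simp
  qed
  obtain F where F: "F \<subseteq> edges G" "card F = chromatic_edge_stability_index G"
    "chromatic_index (delete_edges G F) < d"
    unfolding d_def using G by (rule chromatic_edge_stability_index_witness)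
  obtain c where c: "proper_edge_colouring (delete_edges G F) (chromatic_index (delete_edges G F)) c"
    using simple_graph_delete_edges[OF G(1)] by (rule chromatic_index_colouring)
  let ?M = "\<lambda>a. {e \<in> edges G - F. c e = a}"
  have M: "card (?M a) \<le> k - 1" for a
  proof -
    have disj: "e \<inter> f = {}" if "e \<in> ?M a" "f \<in> ?M a" "e \<noteq> f" for e f
    proof -
      have "e \<in> edges (delete_edges G F)" "f \<in> edges (delete_edges G F)" "c e = c f"
        using that by (auto simp: delete_edges_def)
      then show ?thesis using c that(3) unfolding proper_edge_colouring_def by meson
    qed
    have fin_M: "finite (?M a)" using finite_edge_set by auto
    have "2 * card {e \<in> ?M a. e \<subseteq> X} + 1 \<le> card X" if "X \<in> {U, W}" for X
      using that fin odd fin_M disj edgeD(2) by (intro odd_matching_bound) auto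
    then have "2 * card {e \<in> ?M a. e \<subseteq> U} + 1 \<le> card U" "2 * card {e \<in> ?M a. e \<subseteq> W} + 1 \<le> card W" by auto
    moreover have "card (?M a) \<le> card ({e \<in> ?M a. e \<subseteq> U} \<union> {e \<in> ?M a. e \<subseteq> W})"
    proof (rule card_mono)
      show "finite ({e \<in> ?M a. e \<subseteq> U} \<union> {e \<in> ?M a. e \<subseteq> W})" using finite_edge_set by simp
    qed (auto simp: E)
    then have "card (?M a) \<le> card {e \<in> ?M a. e \<subseteq> U} + card {e \<in> ?M a. e \<subseteq> W}"
      using card_Un_le order_trans by blast
    ultimately show ?thesis using cards by linarith
  qed
  have "c e < d - 1" if "e \<in> edges G - F" for e
  proof -
    have "c e < chromatic_index (delete_edges G F)"
      using c that by (simp add: proper_edge_colouring_def delete_edges_def)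
    then show ?thesis using F(3) by linarith
  qed
  then have union: "edges G - F = (\<Union>a\<in>{..<d - 1}. ?M a)" by auto
  have "card (edges G - F) \<le> (\<Sum>a<d - 1. card (?M a))"
    by (rule ord_eq_le_trans[OF arg_cong[OF union, of card] card_UN_le]) simp
  also have "\<dots> \<le> (d - 1) * (k - 1)" using sum_bounded_above[of "{..<d - 1}" "\<lambda>a. card (?M a)" "k - 1"] M by simp
  finally have "card (edges G - F) \<le> (d - 1) * (k - 1)" .
  moreover have "card (edges G) = card (edges G - F) + card F"
    using F(1) finite_edge_set by (simp add: card_Diff_subset card_mono finite_subset)
  moreover have "d * (k - 1) = (d - 1) * (k - 1) + (k - 1)" using d_pos by (cases d) auto
  ultimately show ?thesis using F(2) edges_ge by linarith
qed

section \<open>The extremal graphs up to isomorphism\<close>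

lemma disjoint_union_complete_edge:
  "{p, q} \<in> edges (disjoint_union (complete_graph i) (complete_graph j)) \<longleftrightarrow>
    p \<noteq> q \<and> ({p, q} \<subseteq> Inl ` {..<i} \<or> {p, q} \<subseteq> Inr ` {..<j})"
proof
  assume "{p, q} \<in> edges (disjoint_union (complete_graph i) (complete_graph j))"
  then obtain e where "{p, q} = Inl ` e \<and> e \<subseteq> {..<i} \<and> card e = 2 \<or> {p, q} = Inr ` e \<and> e \<subseteq> {..<j} \<and> card e = 2"
    by (auto simp: disjoint_union_def complete_graph_def)
  then have "card {p, q} = 2 \<and> ({p, q} \<subseteq> Inl ` {..<i} \<or> {p, q} \<subseteq> Inr ` {..<j})"
    by (metis card_image image_mono inj_Inl inj_Inr)
  then show "p \<noteq> q \<and> ({p, q} \<subseteq> Inl ` {..<i} \<or> {p, q} \<subseteq> Inr ` {..<j})" by auto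
next
  assume *: "p \<noteq> q \<and> ({p, q} \<subseteq> Inl ` {..<i} \<or> {p, q} \<subseteq> Inr ` {..<j})"
  then consider a b where "p = Inl a" "q = Inl b" "a < i" "b < i" "a \<noteq> b"
    | a b where "p = Inr a" "q = Inr b" "a < j" "b < j" "a \<noteq> b" by auto
  then show "{p, q} \<in> edges (disjoint_union (complete_graph i) (complete_graph j))"
  proof cases
    case (1 a b)
    then show ?thesis
      by (auto simp: disjoint_union_def complete_graph_def intro!: image_eqI[of _ _ "{a, b}"])
  next
    case (2 a b)
    then show ?thesis
      by (auto simp: disjoint_union_def complete_graph_def intro!: image_eqI[of _ _ "{a, b}"])
  qed
qed

lemma graph_iso_disjoint_union_complete:
  assumes G: "simple_graph G"
  shows "graph_iso G (disjoint_union (complete_graph i) (complete_graph j)) \<longleftrightarrow>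
    (\<exists>U W. clique_pair G U W \<and> card U = i \<and> card W = j)"
proof -
  interpret palette G 0 by unfold_locales (rule G)
  let ?H = "disjoint_union (complete_graph i) (complete_graph j)"
  have VH: "verts ?H = Inl ` {..<i} \<union> Inr ` {..<j}"
    by (auto simp: disjoint_union_def complete_graph_def)
  show ?thesis
  proof
    assume "graph_iso G ?H"
    then obtain f where f: "bij_betw f (verts G) (verts ?H)"
      and iso: "\<And>u v. u \<in> verts G \<Longrightarrow> v \<in> verts G \<Longrightarrow> {u, v} \<in> edges G \<longleftrightarrow> {f u, f v} \<in> edges ?H"
      unfolding graph_iso_def by blast
    define U where "U = {v \<in> verts G. f v \<in> Inl ` {..<i}}"
    define W where "W = {v \<in> verts G. f v \<in> Inr ` {..<j}}"
    have inj: "inj_on f (verts G)" and img: "f ` verts G = verts ?H" using f by (auto simp: bij_betw_def)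
    have fU: "f ` U = Inl ` {..<i}" and fW: "f ` W = Inr ` {..<j}"
    proof -
      have "f ` {v \<in> verts G. f v \<in> S} = f ` verts G \<inter> S" for S by blast
      then show "f ` U = Inl ` {..<i}" "f ` W = Inr ` {..<j}"
        unfolding U_def W_def img VH by auto
    qed
    have "card (f ` U) = card U" "card (f ` W) = card W"
      using inj by (auto intro!: card_image inj_on_subset[OF inj] simp: U_def W_def)
    then have "card U = i" "card W = j" by (simp_all add: fU fW card_image)
    moreover have "clique_pair G U W" unfolding clique_pair_def
    proof (intro conjI)
      have "f v \<in> Inl ` {..<i} \<union> Inr ` {..<j}" if "v \<in> verts G" for v
        using bij_betwE[OF f] that VH by simp
      then show V: "verts G = U \<union> W" unfolding U_def W_def by auto
      show "U \<inter> W = {}" unfolding U_def W_def by auto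
      have edge: "{x, y} \<in> edges G \<longleftrightarrow> x \<noteq> y \<and> ({x, y} \<subseteq> U \<or> {x, y} \<subseteq> W)"
        if "x \<in> verts G" "y \<in> verts G" for x y
        using iso[OF that] inj_onD[OF inj, of x y] that
        unfolding disjoint_union_complete_edge by (auto simp: U_def W_def)
      show "edges G = {e. card e = 2 \<and> (e \<subseteq> U \<or> e \<subseteq> W)}"
      proof (intro set_eqI)
        fix e
        show "e \<in> edges G \<longleftrightarrow> e \<in> {e. card e = 2 \<and> (e \<subseteq> U \<or> e \<subseteq> W)}"
        proof (cases "card e = 2 \<and> e \<subseteq> verts G")
          case True
          then obtain x y where "e = {x, y}" "x \<noteq> y" unfolding card_2_iff by blast
          then show ?thesis using edge[of x y] True by auto
        next
          case False
          then show ?thesis using edgeD[of e] V by auto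
        qed
      qed
    qed
    ultimately show "\<exists>U W. clique_pair G U W \<and> card U = i \<and> card W = j" by blast
  next
    assume "\<exists>U W. clique_pair G U W \<and> card U = i \<and> card W = j"
    then obtain U W where V: "verts G = U \<union> W" "U \<inter> W = {}"
      and E: "edges G = {e. card e = 2 \<and> (e \<subseteq> U \<or> e \<subseteq> W)}" and card: "card U = i" "card W = j"
      by (auto simp: clique_pair_def)
    have "finite U" "finite W" using finite_verts V by auto
    then obtain g h where g: "bij_betw g U {..<i}" and h: "bij_betw h W {..<j}"
      using card ex_bij_betw_finite_nat[of U] ex_bij_betw_finite_nat[of W] by (auto simp: atLeast0LessThan)
    define f where "f v = (if v \<in> U then Inl (g v) else Inr (h v))" for v
    have fU: "bij_betw f U (Inl ` {..<i})"
    proof (rule bij_betw_imageI)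
      show "inj_on f U" using bij_betw_imp_inj_on[OF g] by (auto simp: inj_on_def f_def)
      show "f ` U = Inl ` {..<i}"
        unfolding bij_betw_imp_surj_on[OF g, symmetric] by (auto simp: f_def)
    qed
    have fW: "bij_betw f W (Inr ` {..<j})"
    proof (rule bij_betw_imageI)
      have W: "f v = Inr (h v)" if "v \<in> W" for v using that V(2) by (auto simp: f_def)
      show "inj_on f W" using bij_betw_imp_inj_on[OF h] W by (auto simp: inj_on_def)
      show "f ` W = Inr ` {..<j}"
        unfolding bij_betw_imp_surj_on[OF h, symmetric] using W by (auto simp: image_image)
    qed
    have f: "bij_betw f (verts G) (verts ?H)"
      unfolding V(1) VH by (rule bij_betw_combine[OF fU fW]) auto
    have sides: "f x \<in> Inl ` {..<i} \<longleftrightarrow> x \<in> U" "f x \<in> Inr ` {..<j} \<longleftrightarrow> x \<in> W" if "x \<in> verts G" for x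
      using that V bij_betwE[OF fU] bij_betwE[OF fW] by (auto simp: f_def)
    have "{x, y} \<in> edges G \<longleftrightarrow> {f x, f y} \<in> edges ?H" if xy: "x \<in> verts G" "y \<in> verts G" for x y
    proof -
      have "f x \<noteq> f y \<longleftrightarrow> x \<noteq> y" using bij_betw_imp_inj_on[OF f] xy by (auto dest: inj_onD)
      then show ?thesis using sides xy by (auto simp: disjoint_union_complete_edge E card_2_iff)
    qed
    then show "graph_iso G ?H" using f unfolding graph_iso_def by blast
  qed
qed

theorem theorem5p6:
  fixes G :: "'a ugraph" and n :: nat
  assumes "simple_graph G"
    and "edges G \<noteq> {}"
    and "graph_order G = n"
    and "even n"
    and "class2 G"
  shows "chromatic_edge_stability_index G = n div 2 - 1 \<longleftrightarrow>
      graph_iso G (disjoint_union (complete_graph 1) (complete_graph (n - 1))) \<or>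
      (\<exists>m::nat. m > 0 \<and>
         graph_iso G (disjoint_union (complete_graph (2 * m + 1)) (complete_graph (2 * m + 1))))"
proof -
  obtain k where n: "n = 2 * k" using assms(4) by (rule evenE)
  then have order: "card (verts G) = 2 * k" using assms(3) by (simp add: graph_order_def)
  have sizes: "card U + card W = 2 * k" if "clique_pair G U W" for U W
    using that order assms(1) card_Un_disjoint[of U W] by (auto simp: clique_pair_def simple_graph_def)
  have "chromatic_edge_stability_index G = k - 1 \<longleftrightarrow>
      (\<exists>U W. clique_pair G U W \<and> card U = 1 \<and> card W = n - 1) \<or>
      (\<exists>m::nat. m > 0 \<and> (\<exists>U W. clique_pair G U W \<and> card U = 2 * m + 1 \<and> card W = 2 * m + 1))"
    (is "?es \<longleftrightarrow> ?single \<or> ?equal")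
  proof
    assume ?es
    with assms(1,2) order assms(5) obtain U W where UW: "clique_pair G U W"
      and "card U = 1 \<or> odd (card U) \<and> 2 \<le> card U \<and> card U = card W"
      by (rule extremal_clique_pair)
    then consider "card U = 1" | "odd (card U)" "2 \<le> card U" "card U = card W" by blast
    then show "?single \<or> ?equal"
    proof cases
      case 1
      then have "card W = n - 1" using sizes[OF UW] n by simp
      then show ?thesis using UW 1 by blast
    next
      case 2
      then obtain m where "card U = 2 * m + 1" by (auto elim: oddE)
      then show ?thesis using UW 2 by (intro disjI2 exI[of _ m]) auto
    qed
  next
    assume "?single \<or> ?equal"
    then obtain U W where UW: "clique_pair G U W" and "odd (card U)" "card U = 1 \<or> card U = card W"
      by auto
    moreover have "odd (card W)" using sizes[OF UW] \<open>odd (card U)\<close> by presburger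
    ultimately have "k - 1 \<le> chromatic_edge_stability_index G"
      using clique_pair_edge_stability[OF assms(1,2) order assms(5)] by blast
    then show ?es using class2_edge_stability_upper_bound[OF assms(1,2) order assms(5)] by linarith
  qed
  then show ?thesis
    using graph_iso_disjoint_union_complete[OF assms(1)] n by simp
qed

end
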